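(* In any nominal transition system, let $S$ be a set of states that is finitely supported and closed under bisimilarity (if $P\in S$ and $P\stackrel{\cdot}{\sim}Q$ then $Q\in S$). Then there exists a formula $A$ such that for every state $P$: $P\models A$ iff $P\in S$.
   Context: Nominal sets over a countably infinite (possibly sorted) set of names $\mathcal N$: permutations fix all but finitely many names; every element has finite support $\operatorname{supp}$; a set of states is finitely supported if it has finite support under the pointwise permutation action; $a\# X$ means $a\notin\operatorname{supp}(X)$; $[\mathcal P_{\mathrm{fin}}(\mathcal N)]S$ is $\mathcal P_{\mathrm{fin}}(\mathcal N)\times S$ modulo $(N,X)=_\alpha(N',X')$ iff some permutation $\pi$ with $\pi\cdot(N,X)=(N',X')$ fixes every name in $\operatorname{supp}(X)\setminus N$; classes $\langle N\rangle X$. A nominal transition system: nominal sets STATES, PRED, ACT; equivariant $\vdash\subseteq\mathrm{STATES}\times\mathrm{PRED}$; equivariant $\operatorname{bn}$, $\operatorname{bn}(\alpha)$ a finite subset of $\operatorname{supp}(\alpha)$; equivariant $\rightarrow\ \subseteq\mathrm{STATES}\times[\mathcal P_{\mathrm{fin}}(\mathcal N)](\mathrm{ACT}\times\mathrm{STATES})$ with $(P,\langle N\rangle(\alpha,Q))\in\rightarrow$ only if $N=\operatorname{bn}(\alpha)$; $P\xrightarrow{\alpha}P'$ means $(P,\langle\operatorname{bn}(\alpha)\rangle(\alpha,P'))\in\rightarrow$. A bisimulation is a symmetric relation $R$ on states with: $R(P,Q)$ implies (1) $P\vdash\varphi\Rightarrow Q\vdash\varphi$ for all $\varphi$, (2)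 whenever $\operatorname{bn}(\alpha)\# Q$ and $P\xrightarrow{\alpha}P'$ there is $Q'$ with $Q\xrightarrow{\alpha}Q'$ and $R(P',Q')$. $P\stackrel{\cdot}{\sim}Q$ iff some bisimulation relates them. Formulas: fix an infinite cardinal $\kappa>\aleph_0$ with $\kappa>|\mathrm{STATES}|$; formulas are $\bigwedge_{i\in I}A_i$ (with $\{A_i\mid i\in I\}$ of cardinality $<\kappa$ and finitely supported), $\neg A$, $\varphi\in\mathrm{PRED}$, $\langle\alpha\rangle A$ with $\operatorname{bn}(\alpha)$ bound in $\alpha$ and $A$. Satisfaction: $P\models\bigwedge A_i$ iff all $P\models A_i$; $P\models\neg A$ iff not $P\models A$; $P\models\varphi$ iff $P\vdash\varphi$; $P\models\langle\alpha\rangle A$ iff for a representative with $\operatorname{bn}(\alpha)\# P$ some $P'$ has $P\xrightarrow{\alpha}P'$ and $P'\models A$. *)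

theory Defs
  imports Main "HOL-Library.Countable_Set" "HOL-Combinatorics.Perm"
begin

unbundle cardinal_syntax and permutation_syntax

section \<open>Nominal sets\<close>

text \<open>Names form a type \<open>'n\<close> with a sorting \<open>srt\<close>; the unsorted case is a constant \<open>srt\<close>.
  As usual for sorted names, there are infinitely many names of each occurring sort and
  permutations respect sorts. Elements of type \<open>'n perm\<close> move only finitely many names.\<close>

definition name_sorting :: "('n \<Rightarrow> 's) \<Rightarrow> bool" where
  "name_sorting srt \<longleftrightarrow> countable (UNIV :: 'n set) \<and> infinite (UNIV :: 'n set) \<and>
     (\<forall>a. infinite {b. srt b = srt a})"

definition perms :: "('n \<Rightarrow> 's) \<Rightarrow> 'n perm set" where
  "perms srt = {\<pi>. \<forall>a. srt (\<pi> \<langle>$\<rangle> a) = srt a}"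

type_synonym ('n, 'a) action = "'n perm \<Rightarrow> 'a \<Rightarrow> 'a"

definition name_set_act :: "('n, 'n set) action" where
  "name_set_act \<pi> N = (\<lambda>a. \<pi> \<langle>$\<rangle> a) ` N"

definition set_act :: "('n, 'a) action \<Rightarrow> ('n, 'a set) action" where
  "set_act f \<pi> X = f \<pi> ` X"

definition prod_act :: "('n, 'a) action \<Rightarrow> ('n, 'b) action \<Rightarrow> ('n, 'a \<times> 'b) action" where
  "prod_act f g \<pi> = map_prod (f \<pi>) (g \<pi>)"

definition supports :: "('n \<Rightarrow> 's) \<Rightarrow> ('n, 'a) action \<Rightarrow> 'n set \<Rightarrow> 'a \<Rightarrow> bool" where
  "supports srt f N x \<longleftrightarrow> (\<forall>\<pi>\<in>perms srt. (\<forall>a\<in>N. \<pi> \<langle>$\<rangle> a = a) \<longrightarrow> f \<pi> x = x)"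

definition finitely_supported :: "('n \<Rightarrow> 's) \<Rightarrow> ('n, 'a) action \<Rightarrow> 'a \<Rightarrow> bool" where
  "finitely_supported srt f x \<longleftrightarrow> (\<exists>N. finite N \<and> supports srt f N x)"

definition supp :: "('n \<Rightarrow> 's) \<Rightarrow> ('n, 'a) action \<Rightarrow> 'a \<Rightarrow> 'n set" where
  "supp srt f x = \<Inter>{N. finite N \<and> supports srt f N x}"

definition fresh :: "('n \<Rightarrow> 's) \<Rightarrow> ('n, 'a) action \<Rightarrow> 'n set \<Rightarrow> 'a \<Rightarrow> bool" where
  "fresh srt f N x \<longleftrightarrow> (\<forall>a\<in>N. a \<notin> supp srt f x)"

definition nominal_set :: "('n \<Rightarrow> 's) \<Rightarrow> ('n, 'a) action \<Rightarrow> 'a set \<Rightarrow> bool" where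
  "nominal_set srt f X \<longleftrightarrow>
     (\<forall>\<pi>\<in>perms srt. \<forall>x\<in>X. f \<pi> x \<in> X) \<and>
     (\<forall>x\<in>X. f 1 x = x) \<and>
     (\<forall>\<pi>\<in>perms srt. \<forall>\<sigma>\<in>perms srt. \<forall>x\<in>X. f (\<pi> * \<sigma>) x = f \<pi> (f \<sigma> x)) \<and>
     (\<forall>x\<in>X. finitely_supported srt f x)"

definition abs_eq ::
  "('n \<Rightarrow> 's) \<Rightarrow> ('n, 'a) action \<Rightarrow> 'n set \<times> 'a \<Rightarrow> 'n set \<times> 'a \<Rightarrow> bool" where
  "abs_eq srt f NX NX' \<longleftrightarrow>
     (\<exists>\<pi>\<in>perms srt. prod_act name_set_act f \<pi> NX = NX' \<and>
        (\<forall>a \<in> supp srt f (snd NX) - fst NX. \<pi> \<langle>$\<rangle> a = a))"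

definition abs_class ::
  "('n \<Rightarrow> 's) \<Rightarrow> ('n, 'a) action \<Rightarrow> 'n set \<Rightarrow> 'a \<Rightarrow> ('n set \<times> 'a) set" where
  "abs_class srt f N x = {NX'. abs_eq srt f (N, x) NX'}"

definition abs_set ::
  "('n \<Rightarrow> 's) \<Rightarrow> ('n, 'a) action \<Rightarrow> 'a set \<Rightarrow> ('n set \<times> 'a) set set" where
  "abs_set srt f X = {abs_class srt f N x | N x. finite N \<and> x \<in> X}"


section \<open>Nominal transition systems\<close>

text \<open>States, predicates and actions are carrier sets, so that any of them may be empty.\<close>

record ('n, 's, 'st, 'pr, 'ac) nts =
  name_sort :: "'n \<Rightarrow> 's"
  states :: "'st set"
  state_act :: "('n, 'st) action"
  preds :: "'pr set"
  pred_act :: "('n, 'pr) action"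
  acts :: "'ac set"
  act_act :: "('n, 'ac) action"
  entails :: "('st \<times> 'pr) set"
  bn :: "'ac \<Rightarrow> 'n set"
  transitions :: "('st \<times> ('n set \<times> ('ac \<times> 'st)) set) set"

abbreviation residual_act ::
  "('n, 's, 'st, 'pr, 'ac) nts \<Rightarrow> ('n, 'ac \<times> 'st) action" where
  "residual_act T \<equiv> prod_act (act_act T) (state_act T)"

definition nominal_transition_system :: "('n, 's, 'st, 'pr, 'ac) nts \<Rightarrow> bool" where
  "nominal_transition_system T \<longleftrightarrow>
     name_sorting (name_sort T) \<and>
     nominal_set (name_sort T) (state_act T) (states T) \<and>
     nominal_set (name_sort T) (pred_act T) (preds T) \<and>
     nominal_set (name_sort T) (act_act T) (acts T) \<and>
     entails T \<subseteq> states T \<times> preds T \<and>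
     (\<forall>\<pi>\<in>perms (name_sort T). \<forall>(P, \<phi>)\<in>entails T.
        (state_act T \<pi> P, pred_act T \<pi> \<phi>) \<in> entails T) \<and>
     (\<forall>\<alpha>\<in>acts T. finite (bn T \<alpha>) \<and> bn T \<alpha> \<subseteq> supp (name_sort T) (act_act T) \<alpha>) \<and>
     (\<forall>\<pi>\<in>perms (name_sort T). \<forall>\<alpha>\<in>acts T.
        bn T (act_act T \<pi> \<alpha>) = name_set_act \<pi> (bn T \<alpha>)) \<and>
     transitions T \<subseteq>
       states T \<times> abs_set (name_sort T) (residual_act T) (acts T \<times> states T) \<and>
     (\<forall>\<pi>\<in>perms (name_sort T). \<forall>(P, C)\<in>transitions T.
        (state_act T \<pi> P, set_act (prod_act name_set_act (residual_act T)) \<pi> C)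
          \<in> transitions T) \<and>
     (\<forall>P\<in>states T. \<forall>N. \<forall>\<alpha>\<in>acts T. \<forall>Q\<in>states T.
        finite N \<longrightarrow>
        (P, abs_class (name_sort T) (residual_act T) N (\<alpha>, Q)) \<in> transitions T \<longrightarrow>
        N = bn T \<alpha>)"

definition step ::
  "('n, 's, 'st, 'pr, 'ac) nts \<Rightarrow> 'st \<Rightarrow> 'ac \<Rightarrow> 'st \<Rightarrow> bool" where
  "step T P \<alpha> P' \<longleftrightarrow> P \<in> states T \<and> \<alpha> \<in> acts T \<and> P' \<in> states T \<and>
     (P, abs_class (name_sort T) (residual_act T) (bn T \<alpha>) (\<alpha>, P')) \<in> transitions T"

definition bisimulation :: "('n, 's, 'st, 'pr, 'ac) nts \<Rightarrow> 'st rel \<Rightarrow> bool" where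
  "bisimulation T R \<longleftrightarrow> R \<subseteq> states T \<times> states T \<and> sym R \<and>
     (\<forall>(P, Q)\<in>R.
        (\<forall>\<phi>\<in>preds T. (P, \<phi>) \<in> entails T \<longrightarrow> (Q, \<phi>) \<in> entails T) \<and>
        (\<forall>\<alpha>\<in>acts T. \<forall>P'\<in>states T.
           fresh (name_sort T) (state_act T) (bn T \<alpha>) Q \<longrightarrow> step T P \<alpha> P' \<longrightarrow>
           (\<exists>Q'\<in>states T. step T Q \<alpha> Q' \<and> (P', Q') \<in> R)))"

definition bisimilar :: "('n, 's, 'st, 'pr, 'ac) nts \<Rightarrow> 'st \<Rightarrow> 'st \<Rightarrow> bool" where
  "bisimilar T P Q \<longleftrightarrow> (\<exists>R. bisimulation T R \<and> (P, Q) \<in> R)"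


section \<open>Formulas\<close>

text \<open>Raw formulas are infinitary syntax trees before identification up to renaming of bound
  names. The family of conjuncts is indexed by the domain of a partial function on \<open>'k\<close>, the type
  carrying the cardinal \<open>\<kappa>\<close>; any set of fewer than \<open>\<kappa>\<close> conjuncts can be indexed in this way.\<close>

datatype ('k, 'pr, 'ac) raw =
    Conj "'k \<rightharpoonup> ('k, 'pr, 'ac) raw"
  | Neg "('k, 'pr, 'ac) raw"
  | Pred 'pr
  | Dia 'ac "('k, 'pr, 'ac) raw"

definition raw_act ::
  "('n, 's, 'st, 'pr, 'ac) nts \<Rightarrow> ('n, ('k, 'pr, 'ac) raw) action" where
  "raw_act T \<pi> = map_raw (pred_act T \<pi>) (act_act T \<pi>)"

inductive child :: "('k, 'pr, 'ac) raw \<Rightarrow> ('k, 'pr, 'ac) raw \<Rightarrow> bool" where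
  "t \<in> ran f \<Longrightarrow> child t (Conj f)"
| "child t (Neg t)"
| "child t (Dia \<alpha> t)"

lemma wf_child: "wf {(s, t). child s t}"
proof -
  have "Wellfounded.accp child t" for t :: "('k, 'pr, 'ac) raw"
  proof (induction t)
    case (Conj f)
    have "Wellfounded.accp child s" if "s \<in> ran f" for s
    proof -
      from that obtain i where i: "f i = Some s" by (auto simp: ran_def)
      then have "Some s \<in> range f" by (metis rangeI)
      then show ?thesis by (rule Conj) simp
    qed
    then show ?case by - (rule accp.accI, erule child.cases, auto)
  next
    case (Neg t)
    then show ?case by - (rule accp.accI, erule child.cases, auto)
  next
    case (Pred \<phi>)
    then show ?case by - (rule accp.accI, erule child.cases, auto)
  next
    case (Dia \<alpha> t)
    then show ?case by - (rule accp.accI, erule child.cases, auto)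
  qed
  then have "wfP child" by (intro accp_wfpI allI)
  then show ?thesis by (simp add: wfp_def)
qed

definition raw_shape :: "('k, 'pr, 'ac) raw \<Rightarrow> ('k, unit, unit) raw" where
  "raw_shape = map_raw (\<lambda>_. ()) (\<lambda>_. ())"

lemma raw_shape_act [simp]: "raw_shape (raw_act T \<pi> t) = raw_shape t"
  by (simp add: raw_shape_def raw_act_def raw.map_comp comp_def)

lemma raw_shape_child: "child s t \<Longrightarrow> child (raw_shape s) (raw_shape t)"
proof (induction rule: child.induct)
  case (1 t f)
  then obtain i where "f i = Some t" by (auto simp: ran_def)
  then have "raw_shape t \<in> ran (map_option raw_shape \<circ> f)" by (auto intro: ranI[of _ i])
  then show ?case by (simp add: raw_shape_def child.intros)
qed (simp_all add: raw_shape_def child.intros)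

text \<open>\<open>alpha_class T t\<close> is the formula denoted by the raw formula \<open>t\<close>, that is, its equivalence
  class. A conjunction is determined by the set of its conjuncts, and \<open>\<langle>\<alpha>\<rangle>A\<close> by the abstraction
  \<open>\<langle>bn \<alpha>\<rangle>(\<alpha>, A)\<close>, where \<open>A\<close> is itself a class, so that \<open>supp A\<close> refers to \<open>A\<close> up to
  alpha-equivalence. Permutations act pointwise on classes.\<close>

abbreviation formula_act ::
  "('n, 's, 'st, 'pr, 'ac) nts \<Rightarrow> ('n, ('k, 'pr, 'ac) raw set) action" where
  "formula_act T \<equiv> set_act (raw_act T)"

function alpha_class ::
  "('n, 's, 'st, 'pr, 'ac) nts \<Rightarrow> ('k, 'pr, 'ac) raw \<Rightarrow> ('k, 'pr, 'ac) raw set" where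
  "alpha_class T (Conj f) =
     {Conj g | g. (\<forall>u\<in>ran g. \<exists>A\<in>alpha_class T ` ran f. u \<in> A) \<and>
                  (\<forall>A\<in>alpha_class T ` ran f. \<exists>u\<in>ran g. u \<in> A)}"
| "alpha_class T (Neg t) = {Neg u | u. u \<in> alpha_class T t}"
| "alpha_class T (Pred \<phi>) = {Pred \<phi>}"
| "alpha_class T (Dia \<alpha> t) =
     {Dia \<beta> u | \<beta> B u. u \<in> B \<and>
        (bn T \<beta>, (\<beta>, B)) \<in> abs_class (name_sort T) (prod_act (act_act T) (formula_act T))
                             (bn T \<alpha>) (\<alpha>, alpha_class T t)}"
  by pat_completeness auto
termination
  by (relation "inv_image {(s, t). child s t} snd")
    (auto simp: wf_child child.intros)

text \<open>The side conditions on conjunctions concern the set of conjuncts as formulas.\<close>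

function well_formed ::
  "('n, 's, 'st, 'pr, 'ac) nts \<Rightarrow> 'k rel \<Rightarrow> ('k, 'pr, 'ac) raw \<Rightarrow> bool" where
  "well_formed T \<kappa> (Conj f) \<longleftrightarrow>
     (\<forall>t\<in>ran f. well_formed T \<kappa> t) \<and>
     |alpha_class T ` ran f| <o \<kappa> \<and>
     finitely_supported (name_sort T) (set_act (formula_act T)) (alpha_class T ` ran f)"
| "well_formed T \<kappa> (Neg t) \<longleftrightarrow> well_formed T \<kappa> t"
| "well_formed T \<kappa> (Pred \<phi>) \<longleftrightarrow> \<phi> \<in> preds T"
| "well_formed T \<kappa> (Dia \<alpha> t) \<longleftrightarrow> \<alpha> \<in> acts T \<and> well_formed T \<kappa> t"
  by pat_completeness auto
termination
  by (relation "inv_image {(s, t). child s t} (snd \<circ> snd)")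
    (auto simp: wf_child child.intros)

definition formulas ::
  "('n, 's, 'st, 'pr, 'ac) nts \<Rightarrow> 'k rel \<Rightarrow> ('k, 'pr, 'ac) raw set set" where
  "formulas T \<kappa> = {alpha_class T t | t. well_formed T \<kappa> t}"

text \<open>In the last clause \<open>\<pi>\<close> ranges over the renamings that lead from \<open>\<langle>\<alpha>\<rangle>A\<close> to its alpha-variants
  \<open>\<langle>\<pi>\<alpha>\<rangle>(\<pi>A)\<close>, where \<open>A\<close> is the class of \<open>t\<close>.\<close>

function raw_sat ::
  "('n, 's, 'st, 'pr, 'ac) nts \<Rightarrow> 'st \<Rightarrow> ('k, 'pr, 'ac) raw \<Rightarrow> bool" where
  "raw_sat T P (Conj f) \<longleftrightarrow> (\<forall>t\<in>ran f. raw_sat T P t)"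
| "raw_sat T P (Neg t) \<longleftrightarrow> \<not> raw_sat T P t"
| "raw_sat T P (Pred \<phi>) \<longleftrightarrow> (P, \<phi>) \<in> entails T"
| "raw_sat T P (Dia \<alpha> t) \<longleftrightarrow>
     (\<exists>\<pi>\<in>perms (name_sort T).
        (\<forall>a \<in> supp (name_sort T) (prod_act (act_act T) (formula_act T)) (\<alpha>, alpha_class T t)
                - bn T \<alpha>. \<pi> \<langle>$\<rangle> a = a) \<and>
        fresh (name_sort T) (state_act T) (bn T (act_act T \<pi> \<alpha>)) P \<and>
        (\<exists>P'. step T P (act_act T \<pi> \<alpha>) P' \<and> raw_sat T P' (raw_act T \<pi> t)))"
  by pat_completeness auto
termination
  by (relation "inv_image {(s, t). child s t} (\<lambda>(T, P, t). raw_shape t)")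
    (auto simp: wf_child raw_shape_child child.intros)

definition satisfies ::
  "('n, 's, 'st, 'pr, 'ac) nts \<Rightarrow> 'st \<Rightarrow> ('k, 'pr, 'ac) raw set \<Rightarrow> bool" where
  "satisfies T P A \<longleftrightarrow> (\<exists>t\<in>A. raw_sat T P t)"

end

theory Submission
  imports Defs "HOL-Library.Countable_Set_Type"
begin

text \<open>Logical equivalence is a bisimulation: if \<open>P \<rightarrow>\<alpha> P'\<close> had no match among the \<open>\<alpha>\<close>-successors of a
  logically equivalent \<open>Q\<close>, a conjunction \<open>A\<close> of formulas distinguishing \<open>P'\<close> from these successors
  would make \<open>\<langle>\<alpha>\<rangle>A\<close> hold at \<open>P\<close> only. The distinguishing formulas are chosen arbitrarily, so the set
  of conjuncts need not be finitely supported; it becomes so after closing it under all permutations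
  that fix a support of \<open>P'\<close>, which by equivariance of satisfaction preserves truth at \<open>P'\<close>. The
  cardinality bound survives because there are only countably many permutations. In the same way each
  state \<open>P\<close> gets a formula that holds at \<open>P\<close> and only at states bisimilar to \<open>P\<close>, and \<open>S\<close> is
  described by the disjunction of the orbits of these formulas, for \<open>P \<in> S\<close>, under the permutations
  that fix a support of \<open>S\<close>.\<close>

section \<open>Permutations\<close>

text \<open>The pointwise stabiliser of \<open>N\<close> as a group. Supports, alpha-variants and
  orbits are all expressed through it, so that many arguments below reduce to translating or
  conjugating this group.\<close>

definition fixing :: "('n \<Rightarrow> 's) \<Rightarrow> 'n set \<Rightarrow> 'n perm set" where
  "fixing srt N = {\<pi> \<in> perms srt. \<forall>a\<in>N. \<pi> \<langle>$\<rangle> a = a}"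

lemma apply_times_apply [simp]: "(f * g) \<langle>$\<rangle> a = f \<langle>$\<rangle> (g \<langle>$\<rangle> a)"
  by (simp add: apply_times)

lemma apply_inverse_apply [simp]:
  "inverse \<pi> \<langle>$\<rangle> (\<pi> \<langle>$\<rangle> a) = a" "\<pi> \<langle>$\<rangle> (inverse \<pi> \<langle>$\<rangle> a) = a"
  by (simp_all add: apply_inverse bij_is_inj bij_is_surj inv_f_f surj_f_inv_f)

lemma inverse_mult_cancel [simp]:
  "inverse \<pi> * (\<pi> * \<sigma>) = (\<sigma> :: 'n perm)" "\<pi> * (inverse \<pi> * \<sigma>) = (\<sigma> :: 'n perm)"
  by (simp_all flip: mult.assoc)

lemma perms_one [simp, intro]: "1 \<in> perms srt"
  and perms_mult [simp, intro]: "\<pi> \<in> perms srt \<Longrightarrow> \<sigma> \<in> perms srt \<Longrightarrow> \<pi> * \<sigma> \<in> perms srt"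
  by (simp_all add: perms_def)

lemma perms_inverse [simp, intro]: "\<pi> \<in> perms srt \<Longrightarrow> inverse \<pi> \<in> perms srt"
  unfolding perms_def mem_Collect_eq by (metis apply_inverse_apply(2))

lemma perms_swap: "srt a = srt b \<Longrightarrow> \<langle>a \<leftrightarrow> b\<rangle> \<in> perms srt"
  unfolding perms_def mem_Collect_eq by (metis apply_swap_same apply_swap_simp)

lemma fixing_perms: "\<pi> \<in> fixing srt N \<Longrightarrow> \<pi> \<in> perms srt"
  and fixing_apply: "\<pi> \<in> fixing srt N \<Longrightarrow> a \<in> N \<Longrightarrow> \<pi> \<langle>$\<rangle> a = a"
  by (simp_all add: fixing_def)

lemma fixing_one [simp, intro]: "1 \<in> fixing srt N"
  and fixing_mult [simp, intro]:
    "\<pi> \<in> fixing srt N \<Longrightarrow> \<sigma> \<in> fixing srt N \<Longrightarrow> \<pi> * \<sigma> \<in> fixing srt N"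
  by (simp_all add: fixing_def)

lemma fixing_inverse [simp, intro]: "\<pi> \<in> fixing srt N \<Longrightarrow> inverse \<pi> \<in> fixing srt N"
  by (simp add: fixing_def) (metis apply_inverse_apply(1))

lemma fixing_antimono: "M \<subseteq> N \<Longrightarrow> fixing srt N \<subseteq> fixing srt M"
  by (auto simp: fixing_def)

text \<open>If \<sigma> fixes a, then \<pi>\<sigma>\<pi>^-1 fixes \<pi>a. This transports supports
  and renaming witnesses along \<pi>.\<close>

lemma fixing_conjugate:
  assumes "\<pi> \<in> perms srt" "\<sigma> \<in> fixing srt N"
  shows "\<pi> * \<sigma> * inverse \<pi> \<in> fixing srt (name_set_act \<pi> N)"
  using assms by (auto simp: fixing_def name_set_act_def)

lemma name_set_act_mult: "name_set_act \<pi> (name_set_act \<sigma> N) = name_set_act (\<pi> * \<sigma>) N"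
  by (auto simp: name_set_act_def)

lemma name_set_act_fixing: "\<pi> \<in> fixing srt N \<Longrightarrow> name_set_act \<pi> N = N"
  by (simp add: fixing_def name_set_act_def)

lemma name_set_act_diff: "name_set_act \<pi> (M - N) = name_set_act \<pi> M - name_set_act \<pi> N"
  unfolding name_set_act_def by (rule image_set_diff) (simp add: bij_is_inj)

text \<open>The names of \<open>N\<close> are moved away one at a time: the image of each new name
  is swapped with a name of the same sort outside \<open>Z\<close> and outside the images placed so
  far. Such a name exists because every sort is infinite.\<close>

lemma fresh_renaming:
  assumes srt: "name_sorting srt" and "finite N" "finite Z"
  obtains \<pi> where "\<pi> \<in> fixing srt (Z - N)" "name_set_act \<pi> N \<inter> Z = {}"
proof -
  from \<open>finite N\<close> have "\<exists>\<pi>\<in>fixing srt (Z - N). name_set_act \<pi> N \<inter> Z = {}"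
  proof (induction N)
    case empty
    then show ?case by (auto simp: name_set_act_def)
  next
    case (insert a N)
    then obtain \<sigma> where \<sigma>: "\<sigma> \<in> fixing srt (Z - N)" "name_set_act \<sigma> N \<inter> Z = {}"
      by blast
    have "infinite {b. srt b = srt a}"
      using srt by (simp add: name_sorting_def)
    moreover have "finite (Z \<union> name_set_act \<sigma> N)"
      using \<open>finite Z\<close> insert.hyps by (simp add: name_set_act_def)
    ultimately have "{b. srt b = srt a} - (Z \<union> name_set_act \<sigma> N) \<noteq> {}"
      by (intro infinite_imp_nonempty Diff_infinite_finite)
    then obtain b where b: "srt b = srt a" "b \<notin> Z \<union> name_set_act \<sigma> N"
      by auto
    let ?\<pi> = "\<langle>\<sigma> \<langle>$\<rangle> a \<leftrightarrow> b\<rangle> * \<sigma>"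
    have "srt (\<sigma> \<langle>$\<rangle> a) = srt b"
      using \<sigma>(1) b by (auto simp: fixing_def perms_def)
    then have "?\<pi> \<in> perms srt"
      using \<sigma>(1) by (auto intro: perms_swap fixing_perms)
    moreover have "?\<pi> \<langle>$\<rangle> x = x" if "x \<in> Z - insert a N" for x
    proof -
      have "\<sigma> \<langle>$\<rangle> x = x" using \<sigma>(1) that by (auto simp: fixing_def)
      moreover have "\<sigma> \<langle>$\<rangle> x \<noteq> \<sigma> \<langle>$\<rangle> a" "x \<noteq> b" using that b by (auto simp: apply_inj)
      ultimately show ?thesis by simp
    qed
    moreover have "?\<pi> \<langle>$\<rangle> x = \<sigma> \<langle>$\<rangle> x" if "x \<in> N" for x
    proof -
      have "\<sigma> \<langle>$\<rangle> x \<noteq> \<sigma> \<langle>$\<rangle> a" using that insert.hyps by (auto simp: apply_inj)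
      moreover have "\<sigma> \<langle>$\<rangle> x \<noteq> b" using that b by (auto simp: name_set_act_def)
      ultimately show ?thesis by simp
    qed
    ultimately show ?case
      using \<sigma>(2) b by (intro bexI[of _ ?\<pi>]) (auto simp: fixing_def name_set_act_def)
  qed
  then show ?thesis using that by blast
qed

text \<open>Cuts \<pi> down to what it does on a finite set. For each new name one more swap
  corrects its image; injectivity keeps the swap from disturbing the values already right.\<close>

lemma local_permutation:
  assumes "\<pi> \<in> perms srt" "finite N"
  obtains \<sigma> where "\<sigma> \<in> fixing srt (- (N \<union> name_set_act \<pi> N))"
    "\<And>a. a \<in> N \<Longrightarrow> \<sigma> \<langle>$\<rangle> a = \<pi> \<langle>$\<rangle> a"
proof -
  from \<open>finite N\<close>
  have "\<exists>\<sigma>\<in>fixing srt (- (N \<union> name_set_act \<pi> N)). \<forall>a\<in>N. \<sigma> \<langle>$\<rangle> a = \<pi> \<langle>$\<rangle> a"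
  proof (induction N)
    case empty
    then show ?case by (auto simp: name_set_act_def)
  next
    case (insert a N)
    then obtain \<sigma> where \<sigma>: "\<sigma> \<in> fixing srt (- (N \<union> name_set_act \<pi> N))"
      "\<And>x. x \<in> N \<Longrightarrow> \<sigma> \<langle>$\<rangle> x = \<pi> \<langle>$\<rangle> x"
      by blast
    let ?\<tau> = "\<langle>\<sigma> \<langle>$\<rangle> a \<leftrightarrow> \<pi> \<langle>$\<rangle> a\<rangle> * \<sigma>"
    have "srt (\<sigma> \<langle>$\<rangle> a) = srt (\<pi> \<langle>$\<rangle> a)"
      using \<sigma>(1) assms by (auto simp: fixing_def perms_def)
    then have "?\<tau> \<in> perms srt"
      using \<sigma>(1) by (auto intro: perms_swap fixing_perms)
    moreover have "?\<tau> \<langle>$\<rangle> x = x" if "x \<notin> insert a N \<union> name_set_act \<pi> (insert a N)" for x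
    proof -
      have "\<sigma> \<langle>$\<rangle> x = x" using \<sigma>(1) that by (auto simp: fixing_def name_set_act_def)
      moreover have "\<sigma> \<langle>$\<rangle> x \<noteq> \<sigma> \<langle>$\<rangle> a" "x \<noteq> \<pi> \<langle>$\<rangle> a"
        using that by (auto simp: apply_inj name_set_act_def)
      ultimately show ?thesis by auto
    qed
    moreover have "?\<tau> \<langle>$\<rangle> x = \<pi> \<langle>$\<rangle> x" if "x \<in> N" for x
    proof -
      have "x \<noteq> a" using that insert.hyps by auto
      then have "\<sigma> \<langle>$\<rangle> x \<noteq> \<sigma> \<langle>$\<rangle> a" "\<pi> \<langle>$\<rangle> x \<noteq> \<pi> \<langle>$\<rangle> a" by (simp_all add: apply_inj)
      then show ?thesis using \<sigma>(2)[OF that] by simp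
    qed
    ultimately show ?case
      by (intro bexI[of _ ?\<tau>]) (auto simp: fixing_def)
  qed
  then show ?thesis using that by blast
qed

text \<open>A permutation is determined by its graph over the names it moves, a finite subset of a
  countable set. The orbits formed later are countable for this reason.\<close>

lemma countable_perm:
  assumes "countable (UNIV :: 'n set)"
  shows "countable (A :: 'n perm set)"
proof -
  let ?graph = "\<lambda>\<pi> :: 'n perm. (\<lambda>a. (a, \<pi> \<langle>$\<rangle> a)) ` affected \<pi>"
  have "inj ?graph"
  proof (rule injI, rule perm_eqI)
    fix \<pi> \<sigma> :: "'n perm" and a
    assume eq: "?graph \<pi> = ?graph \<sigma>"
    have graph: "(b, c) \<in> ?graph \<rho> \<longleftrightarrow> c = \<rho> \<langle>$\<rangle> b \<and> c \<noteq> b" for b c and \<rho> :: "'n perm"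
      by (auto simp: in_affected)
    have "c = \<pi> \<langle>$\<rangle> a \<and> c \<noteq> a \<longleftrightarrow> c = \<sigma> \<langle>$\<rangle> a \<and> c \<noteq> a" for c
      unfolding graph[symmetric] eq ..
    \<comment> \<open>If either image differs from a, it is also the other image; otherwise both
      equal a.\<close>
    from this[of "\<pi> \<langle>$\<rangle> a"] this[of "\<sigma> \<langle>$\<rangle> a"]
    show "\<pi> \<langle>$\<rangle> a = \<sigma> \<langle>$\<rangle> a" by auto
  qed
  moreover have "countable (range ?graph)"
  proof (rule countable_subset)
    show "range ?graph \<subseteq> {G. finite G \<and> G \<subseteq> UNIV}" by auto
    have "countable (UNIV :: ('n \<times> 'n) set)"
      using countable_SIGMA[OF assms, of "\<lambda>_. UNIV"] assms by simp
    then show "countable {G :: ('n \<times> 'n) set. finite G \<and> G \<subseteq> UNIV}"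
      by (rule countable_Collect_finite_subset)
  qed
  ultimately have "countable (UNIV :: 'n perm set)"
    by (rule countable_image_inj_on[rotated])
  then show ?thesis by (rule countable_subset[rotated]) simp
qed


section \<open>Supports\<close>

text \<open>The group laws of \<open>nominal_set\<close> without finite support, since arbitrary
  sets of raw formulas are acted on as well and need not be finitely supported.\<close>

definition perm_action :: "('n \<Rightarrow> 's) \<Rightarrow> ('n, 'a) action \<Rightarrow> 'a set \<Rightarrow> bool" where
  "perm_action srt f X \<longleftrightarrow>
     (\<forall>\<pi>\<in>perms srt. \<forall>x\<in>X. f \<pi> x \<in> X) \<and>
     (\<forall>x\<in>X. f 1 x = x) \<and>
     (\<forall>\<pi>\<in>perms srt. \<forall>\<sigma>\<in>perms srt. \<forall>x\<in>X. f (\<pi> * \<sigma>) x = f \<pi> (f \<sigma> x))"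

lemma perm_actionD:
  assumes "perm_action srt f X" "x \<in> X"
  shows "\<pi> \<in> perms srt \<Longrightarrow> f \<pi> x \<in> X" "f 1 x = x"
    "\<pi> \<in> perms srt \<Longrightarrow> \<sigma> \<in> perms srt \<Longrightarrow> f \<pi> (f \<sigma> x) = f (\<pi> * \<sigma>) x"
  using assms by (auto simp: perm_action_def)

lemma perm_action_inverse:
  assumes "perm_action srt f X" "x \<in> X" "\<pi> \<in> perms srt"
  shows "f (inverse \<pi>) (f \<pi> x) = x" "f \<pi> (f (inverse \<pi>) x) = x"
  by (simp_all add: perm_actionD[OF assms(1,2)] assms(3))

lemma perm_action_name_set: "perm_action srt name_set_act UNIV"
  by (auto simp: perm_action_def name_set_act_def)

lemma perm_action_prod:
  "perm_action srt f X \<Longrightarrow> perm_action srt g Y \<Longrightarrow> perm_action srt (prod_act f g) (X \<times> Y)"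
  by (auto simp: perm_action_def prod_act_def)

lemma perm_action_set:
  assumes "perm_action srt f X"
  shows "perm_action srt (set_act f) (Pow X)"
proof -
  have "f 1 ` A = A" if "A \<subseteq> X" for A
    using that perm_actionD(2)[OF assms] by (auto simp: image_iff subset_iff)
  moreover have "f (\<pi> * \<sigma>) ` A = f \<pi> ` f \<sigma> ` A"
    if "A \<subseteq> X" "\<pi> \<in> perms srt" "\<sigma> \<in> perms srt" for A \<pi> \<sigma>
    unfolding image_image using that assms by (intro image_cong) (auto simp: perm_action_def)
  ultimately show ?thesis
    using assms by (auto simp: perm_action_def set_act_def)
qed

lemma supports_iff_fixing: "supports srt f N x \<longleftrightarrow> (\<forall>\<pi>\<in>fixing srt N. f \<pi> x = x)"
  by (auto simp: supports_def fixing_def)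

lemma supports_mono: "supports srt f M x \<Longrightarrow> M \<subseteq> N \<Longrightarrow> supports srt f N x"
  by (auto simp: supports_def)

lemma supports_prod:
  "supports srt (prod_act f g) N (x, y) \<longleftrightarrow> supports srt f N x \<and> supports srt g N y"
  by (auto simp: supports_def prod_act_def)

text \<open>Conjugation by the inverse of \<pi> carries the stabiliser of \<pi>N back to that of N,
  where the given support applies.\<close>

lemma supports_perm:
  assumes f: "perm_action srt f X" "x \<in> X" and \<pi>: "\<pi> \<in> perms srt" and "supports srt f N x"
  shows "supports srt f (name_set_act \<pi> N) (f \<pi> x)"
  unfolding supports_iff_fixing
proof
  fix \<sigma> assume \<sigma>: "\<sigma> \<in> fixing srt (name_set_act \<pi> N)"
  have "inverse \<pi> * \<sigma> * inverse (inverse \<pi>)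
      \<in> fixing srt (name_set_act (inverse \<pi>) (name_set_act \<pi> N))"
    by (rule fixing_conjugate) (use \<sigma> \<pi> in auto)
  moreover have "name_set_act (inverse \<pi>) (name_set_act \<pi> N) = N"
    by (rule perm_action_inverse[OF perm_action_name_set _ \<pi>]) simp
  ultimately have "f (inverse \<pi> * \<sigma> * \<pi>) x = x"
    using \<open>supports srt f N x\<close> by (simp add: supports_iff_fixing)
  then have "f \<pi> (f (inverse \<pi> * \<sigma> * \<pi>) x) = f \<pi> x" by simp
  then show "f \<sigma> (f \<pi> x) = f \<pi> x"
    using \<pi> fixing_perms[OF \<sigma>] by (simp add: perm_actionD[OF f] mult.assoc)
qed

lemma supp_perm:
  assumes f: "perm_action srt f X" "x \<in> X" and \<pi>: "\<pi> \<in> perms srt"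
  shows "supp srt f (f \<pi> x) = name_set_act \<pi> (supp srt f x)"
proof -
  \<comment> \<open>One inclusion for an arbitrary permutation and element; the other one follows by
    using it for the inverse of \<pi> at the element \<pi>x.\<close>
  have sub: "name_set_act \<rho> (supp srt f y) \<subseteq> supp srt f (f \<rho> y)"
    if "\<rho> \<in> perms srt" "y \<in> X" for \<rho> y
  proof
    fix b assume "b \<in> name_set_act \<rho> (supp srt f y)"
    then obtain a where a: "a \<in> supp srt f y" "b = \<rho> \<langle>$\<rangle> a" by (auto simp: name_set_act_def)
    show "b \<in> supp srt f (f \<rho> y)"
      unfolding supp_def
    proof safe
      fix N assume N: "finite N" "supports srt f N (f \<rho> y)"
      have "supports srt f (name_set_act (inverse \<rho>) N) (f (inverse \<rho>) (f \<rho> y))"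
        by (rule supports_perm[OF f(1)]) (use that N in \<open>auto intro: perm_actionD[OF f(1)]\<close>)
      then have "supports srt f (name_set_act (inverse \<rho>) N) y"
        using perm_action_inverse[OF f(1)] that by simp
      then have "a \<in> name_set_act (inverse \<rho>) N"
        using a N by (auto simp: supp_def name_set_act_def)
      then show "b \<in> N" using a by (auto simp: name_set_act_def)
    qed
  qed
  show ?thesis
  proof
    show "name_set_act \<pi> (supp srt f x) \<subseteq> supp srt f (f \<pi> x)" using sub f \<pi> by blast
    have "name_set_act (inverse \<pi>) (supp srt f (f \<pi> x)) \<subseteq> supp srt f (f (inverse \<pi>) (f \<pi> x))"
      using sub f \<pi> by (blast intro: perm_actionD)
    also have "f (inverse \<pi>) (f \<pi> x) = x" by (rule perm_action_inverse[OF f \<pi>])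
    finally show "supp srt f (f \<pi> x) \<subseteq> name_set_act \<pi> (supp srt f x)"
      unfolding name_set_act_def by (metis apply_inverse_apply(2) image_eqI image_subset_iff subsetI)
  qed
qed

lemma supports_Int:
  assumes srt: "name_sorting srt" and f: "perm_action srt f X" "x \<in> X"
    and M: "finite M" "supports srt f M x" and N: "finite N" "supports srt f N x"
  shows "supports srt f (M \<inter> N) x"
  unfolding supports_iff_fixing
proof
  fix \<pi> assume \<pi>: "\<pi> \<in> fixing srt (M \<inter> N)"
  have "finite (N - M)" "finite (M \<union> affected \<pi>)" using M N by auto
  \<comment> \<open>Renaming \<open>N - M\<close> away from the names moved by \<open>\<pi>\<close> does not change \<open>x\<close>,
    and yields a support of \<open>x\<close> that \<open>\<pi>\<close> fixes.\<close>
  then obtain \<tau> where \<tau>: "\<tau> \<in> fixing srt (M \<union> affected \<pi> - (N - M))"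
      "name_set_act \<tau> (N - M) \<inter> (M \<union> affected \<pi>) = {}"
    using fresh_renaming[OF srt] by metis
  have \<tau>M: "\<tau> \<in> fixing srt M" using \<tau>(1) by (rule rev_subsetD) (auto intro!: fixing_antimono)
  then have "f \<tau> x = x" using M(2) by (simp add: supports_iff_fixing)
  then have "supports srt f (name_set_act \<tau> N) x"
    using supports_perm[OF f fixing_perms[OF \<tau>(1)] N(2)] by simp
  moreover have "\<pi> \<langle>$\<rangle> (\<tau> \<langle>$\<rangle> a) = \<tau> \<langle>$\<rangle> a" if "a \<in> N" for a
  proof (cases "a \<in> M")
    case True
    then show ?thesis using that \<pi> \<tau>M by (simp add: fixing_apply)
  next
    case False
    then have "\<tau> \<langle>$\<rangle> a \<notin> affected \<pi>" using that \<tau>(2) by (auto simp: name_set_act_def)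
    then show ?thesis by (simp add: in_affected)
  qed
  then have "\<pi> \<in> fixing srt (name_set_act \<tau> N)"
    using fixing_perms[OF \<pi>] by (auto simp: fixing_def name_set_act_def)
  ultimately show "f \<pi> x = x" by (simp add: supports_iff_fixing)
qed

text \<open>A finite support of least cardinality lies inside every other finite support, because
  intersecting the two yields a support again and minimality excludes a smaller one. It is therefore
  \<open>supp\<close>.\<close>

lemma supp_supports:
  assumes srt: "name_sorting srt" and f: "perm_action srt f X" "x \<in> X"
    and "finitely_supported srt f x"
  shows "finite (supp srt f x)" "supports srt f (supp srt f x) x"
proof -
  let ?Q = "\<lambda>N. finite N \<and> supports srt f N x"
  define N where "N = arg_min card ?Q"
  have "\<exists>M. ?Q M" using assms(4) by (auto simp: finitely_supported_def)
  then have N: "?Q N" "\<And>M. ?Q M \<Longrightarrow> card N \<le> card M"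
    unfolding N_def using arg_min_natI[of ?Q _ card] arg_min_nat_le[of ?Q _ card] by blast+
  have "N \<subseteq> M" if "?Q M" for M
  proof -
    have "?Q (N \<inter> M)" using supports_Int[OF srt f] N(1) that by simp
    then have "card N \<le> card (N \<inter> M)" by (rule N(2))
    then show ?thesis using N(1) by (metis card_seteq inf.cobounded1 inf.cobounded2)
  qed
  then have "supp srt f x = N" using N(1) unfolding supp_def by blast
  then show "finite (supp srt f x)" "supports srt f (supp srt f x) x" using N(1) by auto
qed

lemma supp_subset: "finite N \<Longrightarrow> supports srt f N x \<Longrightarrow> supp srt f x \<subseteq> N"
  by (auto simp: supp_def)


section \<open>Abstractions\<close>

text \<open>Presents the class as the orbit of its representative under the stabiliser of the free
  names, so equalities of classes become reindexings of a group.\<close>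

lemma abs_class_eq_image:
  "abs_class srt f N x = (\<lambda>\<sigma>. (name_set_act \<sigma> N, f \<sigma> x)) ` fixing srt (supp srt f x - N)"
  by (auto simp: abs_class_def abs_eq_def prod_act_def fixing_def)

text \<open>The stabiliser of the moved free names is the conjugate by \<pi>, and
  \<pi>\<sigma>\<pi>^-1 applied after \<pi> is \<pi>\<sigma>. Equivariance and invariance under
  renaming are both read off this form.\<close>

lemma abs_class_perm:
  assumes f: "perm_action srt f X" "x \<in> X" and \<pi>: "\<pi> \<in> perms srt"
  shows "abs_class srt f (name_set_act \<pi> N) (f \<pi> x) =
    (\<lambda>\<sigma>. (name_set_act (\<pi> * \<sigma>) N, f (\<pi> * \<sigma>) x)) ` fixing srt (supp srt f x - N)"
    (is "_ = ?g ` ?F")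
proof -
  have supp: "supp srt f (f \<pi> x) - name_set_act \<pi> N = name_set_act \<pi> (supp srt f x - N)"
    by (simp add: supp_perm[OF f \<pi>] name_set_act_diff)
  have bij: "fixing srt (name_set_act \<pi> M) = (\<lambda>\<sigma>. \<pi> * \<sigma> * inverse \<pi>) ` fixing srt M" for M
  proof
    show "(\<lambda>\<sigma>. \<pi> * \<sigma> * inverse \<pi>) ` fixing srt M \<subseteq> fixing srt (name_set_act \<pi> M)"
      using fixing_conjugate[OF \<pi>] by auto
    show "fixing srt (name_set_act \<pi> M) \<subseteq> (\<lambda>\<sigma>. \<pi> * \<sigma> * inverse \<pi>) ` fixing srt M"
    proof
      fix \<sigma> assume "\<sigma> \<in> fixing srt (name_set_act \<pi> M)"
      then have "inverse \<pi> * \<sigma> * \<pi> \<in> fixing srt M"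
        using \<pi> by (auto simp: fixing_def name_set_act_def)
      then show "\<sigma> \<in> (\<lambda>\<sigma>. \<pi> * \<sigma> * inverse \<pi>) ` fixing srt M"
        by (rule rev_image_eqI) (simp add: mult.assoc)
    qed
  qed
  show ?thesis
    unfolding abs_class_eq_image supp bij image_image
  proof (rule image_cong[OF refl])
    fix \<sigma> assume "\<sigma> \<in> ?F"
    then have \<sigma>: "\<sigma> \<in> perms srt" by (rule fixing_perms)
    show "(name_set_act (\<pi> * \<sigma> * inverse \<pi>) (name_set_act \<pi> N), f (\<pi> * \<sigma> * inverse \<pi>) (f \<pi> x))
        = ?g \<sigma>"
      using \<pi> \<sigma> by (simp add: name_set_act_mult perm_actionD(3)[OF f] mult.assoc)
  qed
qed

lemma abs_class_equivariant:
  assumes f: "perm_action srt f X" "x \<in> X" and \<pi>: "\<pi> \<in> perms srt"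
  shows "set_act (prod_act name_set_act f) \<pi> (abs_class srt f N x) =
    abs_class srt f (name_set_act \<pi> N) (f \<pi> x)"
  unfolding abs_class_perm[OF assms] unfolding abs_class_eq_image set_act_def image_image prod_act_def
  by (intro image_cong)
    (auto dest!: fixing_perms simp: \<pi> name_set_act_mult perm_actionD(3)[OF f])

text \<open>Left multiplication by \<pi> is a bijection of the stabiliser to which \<pi> belongs, so
  the orbit does not change.\<close>

lemma abs_class_rename:
  assumes f: "perm_action srt f X" "x \<in> X" and \<pi>: "\<pi> \<in> fixing srt (supp srt f x - N)"
  shows "abs_class srt f (name_set_act \<pi> N) (f \<pi> x) = abs_class srt f N x"
proof -
  let ?F = "fixing srt (supp srt f x - N)"
  have F: "?F = (\<lambda>\<sigma>. \<pi> * \<sigma>) ` ?F"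
  proof
    show "(\<lambda>\<sigma>. \<pi> * \<sigma>) ` ?F \<subseteq> ?F" using \<pi> by auto
    show "?F \<subseteq> (\<lambda>\<sigma>. \<pi> * \<sigma>) ` ?F"
    proof
      fix \<sigma> assume "\<sigma> \<in> ?F"
      then have "inverse \<pi> * \<sigma> \<in> ?F" using \<pi> by auto
      then show "\<sigma> \<in> (\<lambda>\<sigma>. \<pi> * \<sigma>) ` ?F" by (rule rev_image_eqI) simp
    qed
  qed
  show ?thesis
    unfolding abs_class_perm[OF f fixing_perms[OF \<pi>]] unfolding abs_class_eq_image
    by (subst (2) F) (simp add: image_image)
qed



section \<open>Formulas up to alpha-equivalence\<close>

lemma raw_act_simps [simp]:
  "raw_act T \<pi> (Conj f) = Conj (map_option (raw_act T \<pi>) \<circ> f)"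
  "raw_act T \<pi> (Neg t) = Neg (raw_act T \<pi> t)"
  "raw_act T \<pi> (Pred \<phi>) = Pred (pred_act T \<pi> \<phi>)"
  "raw_act T \<pi> (Dia \<alpha> t) = Dia (act_act T \<pi> \<alpha>) (raw_act T \<pi> t)"
  by (simp_all add: raw_act_def)

lemma ran_map_option_comp: "ran (map_option g \<circ> f) = g ` ran f"
  by (auto simp: ran_def)

text \<open>Induction along \<open>child\<close>, so that conjuncts appear as members of
  \<open>ran f\<close> and not as option values.\<close>

lemma raw_induct [case_names Conj Neg Pred Dia]:
  assumes "\<And>f. (\<And>t. t \<in> ran f \<Longrightarrow> Q t) \<Longrightarrow> Q (Conj f)" "\<And>t. Q t \<Longrightarrow> Q (Neg t)"
    "\<And>\<phi>. Q (Pred \<phi>)" "\<And>\<alpha> t. Q t \<Longrightarrow> Q (Dia \<alpha> t)"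
  shows "Q t"
proof (induction t rule: wf_induct_rule[OF wf_child])
  case (1 t)
  then have Q: "\<And>s. child s t \<Longrightarrow> Q s" by simp
  show ?case
  proof (cases t)
    case (Conj f)
    then show ?thesis using Q by (metis assms(1) child.intros(1))
  next
    case (Neg s)
    then show ?thesis using Q by (metis assms(2) child.intros(2))
  next
    case (Pred \<phi>)
    then show ?thesis using assms(3) by simp
  next
    case (Dia \<alpha> s)
    then show ?thesis using Q by (metis assms(4) child.intros(3))
  qed
qed

text \<open>Satisfaction of a diamond looks at renamed copies of the subformula, which are not
  subterms. Induction on \<open>raw_shape\<close>, which permutations preserve, supplies the
  hypothesis for all of them.\<close>

lemma raw_induct_act [case_names Conj Neg Pred Dia]:
  fixes T :: "('n, 's, 'st, 'pr, 'ac) nts"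
  assumes "\<And>f. (\<And>t. t \<in> ran f \<Longrightarrow> Q t) \<Longrightarrow> Q (Conj f)"
    "\<And>t. (\<And>\<pi>. Q (raw_act T \<pi> t)) \<Longrightarrow> Q (Neg t)"
    "\<And>\<phi>. Q (Pred \<phi>)" "\<And>\<alpha> t. (\<And>\<pi>. Q (raw_act T \<pi> t)) \<Longrightarrow> Q (Dia \<alpha> t)"
  shows "Q t"
proof (induction t rule: wf_induct_rule[OF wf_inv_image[OF wf_child, of raw_shape]])
  case (1 t)
  have Q: "Q s" if "child (raw_shape s) (raw_shape t)" for s
    using that by (intro 1) (simp add: inv_image_def)
  show ?case
  proof (cases t)
    case (Conj f)
    then show ?thesis using Q by (metis assms(1) child.intros(1) raw_shape_child)
  next
    case (Neg s)
    then have "child (raw_shape (raw_act T \<pi> s)) (raw_shape t)" for \<pi>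
      using raw_shape_child[OF child.intros(2)] by simp
    then show ?thesis using Q Neg by (metis assms(2))
  next
    case (Pred \<phi>)
    then show ?thesis using assms(3) by simp
  next
    case (Dia \<alpha> s)
    then have "child (raw_shape (raw_act T \<pi> s)) (raw_shape t)" for \<pi>
      using raw_shape_child[OF child.intros(3)] by simp
    then show ?thesis using Q Dia by (metis assms(4))
  qed
qed

text \<open>Trees with all labels in the carriers. The actions on predicates and on actions obey the
  group laws only there, so equivariance is stated for these trees.\<close>

definition raws :: "('n, 's, 'st, 'pr, 'ac) nts \<Rightarrow> ('k, 'pr, 'ac) raw set" where
  "raws T = {t. set1_raw t \<subseteq> preds T \<and> set2_raw t \<subseteq> acts T}"

lemma raws_simps [simp]:
  "Conj f \<in> raws T \<longleftrightarrow> ran f \<subseteq> raws T"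
  "Neg t \<in> raws T \<longleftrightarrow> t \<in> raws T"
  "Pred \<phi> \<in> raws T \<longleftrightarrow> \<phi> \<in> preds T"
  "Dia \<alpha> t \<in> raws T \<longleftrightarrow> \<alpha> \<in> acts T \<and> t \<in> raws T"
proof -
  have "ran f = \<Union> (set_option ` range f)"
    by (auto simp: ran_def set_eq_iff image_iff)
  then have "set1_raw (Conj f) = \<Union> (set1_raw ` ran f)" "set2_raw (Conj f) = \<Union> (set2_raw ` ran f)"
    by simp_all
  then show "Conj f \<in> raws T \<longleftrightarrow> ran f \<subseteq> raws T"
    unfolding raws_def by auto
qed (auto simp: raws_def)

lemma well_formed_raws: "well_formed T \<kappa> t \<Longrightarrow> t \<in> raws T"
  by (induction t rule: raw_induct) auto

text \<open>Isolates the fact that the class of a conjunction depends only on the set of classes of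
  its conjuncts.\<close>

definition conj_class :: "('k, 'pr, 'ac) raw set set \<Rightarrow> ('k, 'pr, 'ac) raw set" where
  "conj_class F = {Conj g | g. (\<forall>u\<in>ran g. \<exists>A\<in>F. u \<in> A) \<and> (\<forall>A\<in>F. \<exists>u\<in>ran g. u \<in> A)}"

text \<open>The name set of the abstraction is left arbitrary instead of being tied to
  \<open>bn\<close>; in this form the construction commutes with permutations without side
  conditions.\<close>

definition dia_class ::
  "('n set \<times> 'ac \<times> ('k, 'pr, 'ac) raw set) set \<Rightarrow> ('k, 'pr, 'ac) raw set" where
  "dia_class C = {Dia \<beta> u | N \<beta> B u. (N, \<beta>, B) \<in> C \<and> u \<in> B}"

lemma alpha_class_Conj: "alpha_class T (Conj f) = conj_class (alpha_class T ` ran f)"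
  by (simp add: conj_class_def)

lemma dia_class_act:
  "formula_act T \<pi> (dia_class C) =
    dia_class (set_act (prod_act name_set_act (prod_act (act_act T) (formula_act T))) \<pi> C)"
proof
  show "formula_act T \<pi> (dia_class C) \<subseteq>
    dia_class (set_act (prod_act name_set_act (prod_act (act_act T) (formula_act T))) \<pi> C)"
  proof
    fix v assume "v \<in> formula_act T \<pi> (dia_class C)"
    then obtain N \<beta> B u where C: "(N, \<beta>, B) \<in> C" "u \<in> B" "v = raw_act T \<pi> (Dia \<beta> u)"
      by (auto simp: dia_class_def set_act_def)
    let ?g = "prod_act name_set_act (prod_act (act_act T) (formula_act T))"
    have "(name_set_act \<pi> N, act_act T \<pi> \<beta>, formula_act T \<pi> B) \<in> set_act ?g \<pi> C"
      using C(1) by (auto simp: set_act_def prod_act_def intro!: rev_image_eqI)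
    moreover have "raw_act T \<pi> u \<in> formula_act T \<pi> B"
      using C(2) by (simp add: set_act_def)
    ultimately show "v \<in> dia_class (set_act ?g \<pi> C)"
      using C(3) unfolding dia_class_def by auto
  qed
  show "dia_class (set_act (prod_act name_set_act (prod_act (act_act T) (formula_act T))) \<pi> C)
    \<subseteq> formula_act T \<pi> (dia_class C)"
  proof
    fix v
    assume "v \<in> dia_class (set_act (prod_act name_set_act (prod_act (act_act T) (formula_act T))) \<pi> C)"
    then obtain N \<beta> B u where "(N, \<beta>, B) \<in> C" "u \<in> B" "v = raw_act T \<pi> (Dia \<beta> u)"
      by (auto simp: dia_class_def set_act_def prod_act_def)
    then show "v \<in> formula_act T \<pi> (dia_class C)"
      unfolding set_act_def dia_class_def by blast
  qed
qed

section \<open>Alpha-equivalence classes over a fixed transition system\<close>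

locale nominal_ts =
  fixes T :: "('n, 's, 'st, 'pr, 'ac) nts"
  assumes nts: "nominal_transition_system T"
begin

abbreviation srt :: "'n \<Rightarrow> 's" where
  "srt \<equiv> name_sort T"

abbreviation pair_act :: "('n, 'ac \<times> ('k, 'pr, 'ac) raw set) action" where
  "pair_act \<equiv> prod_act (act_act T) (formula_act T)"

text \<open>The free names of a diamond. They are computed from the class \<open>A\<close>, so names
  bound inside it do not count.\<close>

abbreviation free :: "'ac \<Rightarrow> ('k, 'pr, 'ac) raw set \<Rightarrow> 'n set" where
  "free \<alpha> A \<equiv> supp srt pair_act (\<alpha>, A) - bn T \<alpha>"

lemma sorting: "name_sorting srt"
  using nts by (simp add: nominal_transition_system_def)

lemma nominal_sets:
  "nominal_set srt (state_act T) (states T)"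
  "nominal_set srt (pred_act T) (preds T)"
  "nominal_set srt (act_act T) (acts T)"
  using nts by (simp_all add: nominal_transition_system_def)

lemma states_action: "perm_action srt (state_act T) (states T)"
  and preds_action: "perm_action srt (pred_act T) (preds T)"
  and acts_action: "perm_action srt (act_act T) (acts T)"
  using nominal_sets by (simp_all add: nominal_set_def perm_action_def)

lemma states_finitely_supported: "P \<in> states T \<Longrightarrow> finitely_supported srt (state_act T) P"
  and acts_finitely_supported: "\<alpha> \<in> acts T \<Longrightarrow> finitely_supported srt (act_act T) \<alpha>"
  using nominal_sets by (simp_all add: nominal_set_def)

lemma entails_act:
  "(P, \<phi>) \<in> entails T \<Longrightarrow> \<pi> \<in> perms srt \<Longrightarrow> (state_act T \<pi> P, pred_act T \<pi> \<phi>) \<in> entails T"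
  using nts by (auto simp: nominal_transition_system_def)

lemma bn_act: "\<alpha> \<in> acts T \<Longrightarrow> \<pi> \<in> perms srt \<Longrightarrow> bn T (act_act T \<pi> \<alpha>) = name_set_act \<pi> (bn T \<alpha>)"
  and finite_bn: "\<alpha> \<in> acts T \<Longrightarrow> finite (bn T \<alpha>)"
  using nts by (auto simp: nominal_transition_system_def)

lemma transitions_act:
  "(P, C) \<in> transitions T \<Longrightarrow> \<pi> \<in> perms srt \<Longrightarrow>
    (state_act T \<pi> P, set_act (prod_act name_set_act (residual_act T)) \<pi> C) \<in> transitions T"
  using nts by (auto simp: nominal_transition_system_def)

lemma raws_action: "perm_action srt (raw_act T) (raws T)"
  unfolding perm_action_def raw_act_def
proof (intro conjI ballI)
  fix t :: "('k, 'pr, 'ac) raw" assume t: "t \<in> raws T"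
  show "map_raw (pred_act T 1) (act_act T 1) t = t"
    using t perm_actionD(2)[OF preds_action] perm_actionD(2)[OF acts_action]
    by (subst (2) raw.map_id[symmetric], intro raw.map_cong) (auto simp: raws_def)
  fix \<pi> assume \<pi>: "\<pi> \<in> perms srt"
  show "map_raw (pred_act T \<pi>) (act_act T \<pi>) t \<in> raws T"
    using t \<pi> perm_actionD(1)[OF preds_action] perm_actionD(1)[OF acts_action]
    by (auto simp: raws_def raw.set_map)
  fix \<sigma> assume \<sigma>: "\<sigma> \<in> perms srt"
  show "map_raw (pred_act T (\<pi> * \<sigma>)) (act_act T (\<pi> * \<sigma>)) t =
      map_raw (pred_act T \<pi>) (act_act T \<pi>) (map_raw (pred_act T \<sigma>) (act_act T \<sigma>) t)"
    unfolding raw.map_comp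
    using t \<pi> \<sigma> perm_actionD(3)[OF preds_action] perm_actionD(3)[OF acts_action]
    by (intro raw.map_cong) (auto simp: raws_def)
qed

lemma formulas_action: "perm_action srt (formula_act T) (Pow (raws T))"
  by (rule perm_action_set[OF raws_action])

lemma pair_action: "perm_action srt pair_act (acts T \<times> Pow (raws T))"
  by (rule perm_action_prod[OF acts_action formulas_action])

lemma residual_action: "perm_action srt (residual_act T) (acts T \<times> states T)"
  by (rule perm_action_prod[OF acts_action states_action])

text \<open>The requirement in \<open>alpha_class\<close> that the name set be
  \<open>bn T \<beta>\<close> holds for every member of this abstraction, because \<open>bn\<close>
  is equivariant.\<close>

lemma alpha_class_Dia:
  assumes "\<alpha> \<in> acts T"
  shows "alpha_class T (Dia \<alpha> t) =
    dia_class (abs_class srt pair_act (bn T \<alpha>) (\<alpha>, alpha_class T t))"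
proof -
  have "N = bn T \<beta>"
    if "(N, \<beta>, B) \<in> abs_class srt pair_act (bn T \<alpha>) (\<alpha>, alpha_class T t)" for N \<beta> B
    using that assms by (auto simp: abs_class_eq_image prod_act_def bn_act fixing_perms)
  then show ?thesis
    by (auto simp: dia_class_def)
qed

text \<open>Splits a variant into a change inside the class of \<open>t\<close> followed by one
  renaming of the whole tree.\<close>

lemma alpha_class_Dia_cases:
  assumes "v \<in> alpha_class T (Dia \<alpha> t)" "\<alpha> \<in> acts T"
  obtains \<sigma> u where "\<sigma> \<in> fixing srt (free \<alpha> (alpha_class T t))" "u \<in> alpha_class T t"
    "v = raw_act T \<sigma> (Dia \<alpha> u)"
  using assms(1) unfolding alpha_class_Dia[OF assms(2)]
  by (auto simp: dia_class_def abs_class_eq_image prod_act_def set_act_def that)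

lemma alpha_class_subset_raws: "t \<in> raws T \<Longrightarrow> alpha_class T t \<subseteq> raws T"
proof (induction t rule: raw_induct)
  case (Conj f)
  then show ?case unfolding alpha_class_Conj conj_class_def by fastforce
next
  case (Dia \<alpha> t)
  show ?case
  proof
    fix v assume "v \<in> alpha_class T (Dia \<alpha> t)"
    then obtain \<sigma> u where "\<sigma> \<in> fixing srt (free \<alpha> (alpha_class T t))" "u \<in> alpha_class T t"
      "v = raw_act T \<sigma> (Dia \<alpha> u)"
      using Dia.prems alpha_class_Dia_cases by (metis raws_simps(4))
    then show "v \<in> raws T"
      using Dia by (auto simp del: raw_act_simps intro!: perm_actionD(1)[OF raws_action] fixing_perms)
  qed
qed auto

text \<open>Renaming all conjuncts gives one inclusion for any permutation; the other applies it to
  the inverse and cancels, which requires the trees to lie in \<open>raws\<close>.\<close>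

lemma conj_class_act:
  assumes "F \<subseteq> Pow (raws T)" "\<pi> \<in> perms srt"
  shows "formula_act T \<pi> (conj_class F) = conj_class (formula_act T \<pi> ` F)"
proof -
  have sub: "raw_act T \<sigma> t \<in> conj_class (formula_act T \<sigma> ` G)" if t: "t \<in> conj_class G" for \<sigma> t G
  proof -
    obtain g where g: "t = Conj g" "\<forall>u\<in>ran g. \<exists>A\<in>G. u \<in> A" "\<forall>A\<in>G. \<exists>u\<in>ran g. u \<in> A"
      using t by (auto simp: conj_class_def)
    then show ?thesis
      by (simp add: conj_class_def ran_map_option_comp set_act_def) (meson imageI)
  qed
  show ?thesis
  proof
    show "formula_act T \<pi> (conj_class F) \<subseteq> conj_class (formula_act T \<pi> ` F)"
      using sub by (auto simp: set_act_def)
    show "conj_class (formula_act T \<pi> ` F) \<subseteq> formula_act T \<pi> (conj_class F)"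
    proof
      fix t assume t: "t \<in> conj_class (formula_act T \<pi> ` F)"
      have "formula_act T (inverse \<pi>) ` formula_act T \<pi> ` F = (\<lambda>A. A) ` F"
        unfolding image_image using assms
        by (intro image_cong) (auto simp: perm_action_inverse(1)[OF formulas_action] subset_iff)
      then have "formula_act T (inverse \<pi>) ` formula_act T \<pi> ` F = F" by simp
      then have mem: "raw_act T (inverse \<pi>) t \<in> conj_class F" using sub[OF t] by metis
      have "formula_act T \<pi> A \<subseteq> raws T" if "A \<in> F" for A
        using that assms perm_actionD(1)[OF formulas_action, of A] by auto
      then have "t \<in> raws T"
        using t by (fastforce simp: conj_class_def)
      then have "raw_act T \<pi> (raw_act T (inverse \<pi>) t) = t"
        by (rule perm_action_inverse(2)[OF raws_action _ assms(2)])
      then show "t \<in> formula_act T \<pi> (conj_class F)"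
        using mem unfolding set_act_def by (metis image_eqI)
    qed
  qed
qed

lemma alpha_class_act:
  "t \<in> raws T \<Longrightarrow> \<pi> \<in> perms srt \<Longrightarrow> alpha_class T (raw_act T \<pi> t) = formula_act T \<pi> (alpha_class T t)"
proof (induction t rule: raw_induct)
  case (Conj f)
  have "alpha_class T ` ran f \<subseteq> Pow (raws T)"
    using Conj.prems alpha_class_subset_raws by fastforce
  moreover have "alpha_class T ` raw_act T \<pi> ` ran f = formula_act T \<pi> ` alpha_class T ` ran f"
    unfolding image_image using Conj by (intro image_cong) auto
  ultimately show ?case
    unfolding raw_act_simps alpha_class_Conj
    using Conj.prems by (simp add: ran_map_option_comp conj_class_act)
next
  case (Dia \<alpha> t)
  then have \<alpha>: "\<alpha> \<in> acts T" "act_act T \<pi> \<alpha> \<in> acts T"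
    using perm_actionD(1)[OF acts_action] by auto
  have "(\<alpha>, alpha_class T t) \<in> acts T \<times> Pow (raws T)"
    using Dia.prems alpha_class_subset_raws by auto
  from abs_class_equivariant[OF pair_action this Dia.prems(2), of "bn T \<alpha>"]
  show ?case
    unfolding raw_act_simps alpha_class_Dia[OF \<alpha>(1)] alpha_class_Dia[OF \<alpha>(2)] dia_class_act
    using Dia \<alpha> by (simp add: bn_act prod_act_def)
next
  case (Neg t)
  then show ?case by (force simp: set_act_def)
qed (auto simp: set_act_def)

lemma alpha_class_refl: "t \<in> raws T \<Longrightarrow> t \<in> alpha_class T t"
proof (induction t rule: raw_induct)
  case (Conj f)
  then show ?case by (fastforce simp: alpha_class_Conj conj_class_def)
next
  case (Dia \<alpha> t)
  then have "(\<alpha>, alpha_class T t) \<in> acts T \<times> Pow (raws T)"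
    using alpha_class_subset_raws by auto
  then have "pair_act 1 (\<alpha>, alpha_class T t) = (\<alpha>, alpha_class T t)"
    by (rule perm_actionD(2)[OF pair_action])
  then have "(name_set_act 1 (bn T \<alpha>), \<alpha>, alpha_class T t)
      \<in> abs_class srt pair_act (bn T \<alpha>) (\<alpha>, alpha_class T t)"
    unfolding abs_class_eq_image by (metis (no_types, lifting) fixing_one rev_image_eqI)
  moreover have "\<alpha> \<in> acts T" "t \<in> alpha_class T t" using Dia by auto
  ultimately show ?case
    by (subst alpha_class_Dia) (auto simp: dia_class_def)
qed auto

lemma free_act:
  assumes "\<alpha> \<in> acts T" "A \<subseteq> raws T" "\<pi> \<in> perms srt"
  shows "free (act_act T \<pi> \<alpha>) (formula_act T \<pi> A) = name_set_act \<pi> (free \<alpha> A)"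
  using supp_perm[OF pair_action, of "(\<alpha>, A)" \<pi>] assms
  by (simp add: prod_act_def name_set_act_diff bn_act)

text \<open>Together with \<open>alpha_class_refl\<close> this makes the classes a partition of
  \<open>raws\<close>. In the diamond case the variant differs by a renaming that fixes the free
  names, which leaves the abstraction unchanged.\<close>

lemma alpha_class_eq: "t \<in> raws T \<Longrightarrow> u \<in> alpha_class T t \<Longrightarrow> alpha_class T u = alpha_class T t"
proof (induction t arbitrary: u rule: raw_induct)
  case (Conj f)
  then obtain g where g: "u = Conj g" "\<forall>v\<in>ran g. \<exists>s\<in>ran f. v \<in> alpha_class T s"
      "\<forall>s\<in>ran f. \<exists>v\<in>ran g. v \<in> alpha_class T s"
    by auto
  have eq: "alpha_class T v = alpha_class T s" if "s \<in> ran f" "v \<in> alpha_class T s" for s v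
    using Conj that by auto
  have "alpha_class T v \<in> alpha_class T ` ran f" if v: "v \<in> ran g" for v
  proof -
    obtain s where "s \<in> ran f" "v \<in> alpha_class T s" using g(2) v by blast
    then show ?thesis using eq[of s v] by simp
  qed
  moreover have "alpha_class T s \<in> alpha_class T ` ran g" if s: "s \<in> ran f" for s
  proof -
    obtain v where "v \<in> ran g" "v \<in> alpha_class T s" using g(3) s by blast
    then show ?thesis using eq[OF s, of v] by (metis imageI)
  qed
  ultimately have "alpha_class T ` ran g = alpha_class T ` ran f" by blast
  then show ?case unfolding g(1) alpha_class_Conj by simp
next
  case (Dia \<alpha> t)
  then obtain \<sigma> v where \<sigma>: "\<sigma> \<in> fixing srt (free \<alpha> (alpha_class T t))" and v: "v \<in> alpha_class T t"
      and u: "u = raw_act T \<sigma> (Dia \<alpha> v)"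
    using alpha_class_Dia_cases by (metis raws_simps(4))
  note \<sigma>' = fixing_perms[OF \<sigma>]
  have \<alpha>: "\<alpha> \<in> acts T" "act_act T \<sigma> \<alpha> \<in> acts T" and t: "alpha_class T t \<subseteq> raws T"
    using Dia.prems \<sigma>' perm_actionD(1)[OF acts_action] alpha_class_subset_raws[of t] by auto
  have "alpha_class T (raw_act T \<sigma> v) = formula_act T \<sigma> (alpha_class T t)"
    using alpha_class_act[of v \<sigma>] Dia v t \<sigma>' by auto
  moreover have "abs_class srt pair_act (name_set_act \<sigma> (bn T \<alpha>)) (pair_act \<sigma> (\<alpha>, alpha_class T t))
      = abs_class srt pair_act (bn T \<alpha>) (\<alpha>, alpha_class T t)"
    by (rule abs_class_rename[OF pair_action _ \<sigma>]) (use \<alpha> t in auto)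
  ultimately show ?case
    unfolding u raw_act_simps alpha_class_Dia[OF \<alpha>(1)] alpha_class_Dia[OF \<alpha>(2)]
    using \<sigma>' \<alpha> by (simp add: bn_act prod_act_def)
qed auto


section \<open>Satisfaction\<close>

lemma raw_sat_Dia:
  "raw_sat T P (Dia \<alpha> t) \<longleftrightarrow> (\<exists>\<pi>\<in>fixing srt (free \<alpha> (alpha_class T t)).
     fresh srt (state_act T) (bn T (act_act T \<pi> \<alpha>)) P \<and>
     (\<exists>P'. step T P (act_act T \<pi> \<alpha>) P' \<and> raw_sat T P' (raw_act T \<pi> t)))"
  by (auto simp: fixing_def)

lemma step_act:
  assumes "step T P \<alpha> P'" "\<pi> \<in> perms srt"
  shows "step T (state_act T \<pi> P) (act_act T \<pi> \<alpha>) (state_act T \<pi> P')"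
proof -
  have *: "P \<in> states T" "\<alpha> \<in> acts T" "P' \<in> states T"
    "(P, abs_class srt (residual_act T) (bn T \<alpha>) (\<alpha>, P')) \<in> transitions T"
    using assms(1) by (auto simp: step_def)
  have "(state_act T \<pi> P, abs_class srt (residual_act T)
      (name_set_act \<pi> (bn T \<alpha>)) (residual_act T \<pi> (\<alpha>, P'))) \<in> transitions T"
    using transitions_act[OF *(4) assms(2)]
      abs_class_equivariant[OF residual_action, of "(\<alpha>, P')" \<pi> "bn T \<alpha>"] * assms(2)
    by simp
  then show ?thesis
    using * assms(2) perm_actionD(1)[OF states_action] perm_actionD(1)[OF acts_action]
    by (simp add: step_def bn_act prod_act_def)
qed

text \<open>Unlike in \<open>step_act\<close>, the source state stays put: the renaming fixes the
  free names of the residual, so the transition leads to the same abstraction.\<close>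

lemma step_rename:
  assumes "step T P \<alpha> P'" "\<pi> \<in> fixing srt (supp srt (residual_act T) (\<alpha>, P') - bn T \<alpha>)"
  shows "step T P (act_act T \<pi> \<alpha>) (state_act T \<pi> P')"
  using assms abs_class_rename[OF residual_action _ assms(2)] fixing_perms[OF assms(2)]
    perm_actionD(1)[OF states_action] perm_actionD(1)[OF acts_action]
  by (auto simp: step_def bn_act prod_act_def)

lemma fresh_act:
  assumes "P \<in> states T" "\<pi> \<in> perms srt" "fresh srt (state_act T) N P"
  shows "fresh srt (state_act T) (name_set_act \<pi> N) (state_act T \<pi> P)"
  using assms supp_perm[OF states_action assms(1,2)]
  by (auto simp: fresh_def name_set_act_def apply_inj)

text \<open>One direction suffices because \<pi> can be inverted. The negation case already needs
  the converse for the subformula, obtained from the hypothesis for the renamed subformula and the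
  inverse of \<pi>.\<close>

lemma raw_sat_act_imp:
  "t \<in> raws T \<Longrightarrow> P \<in> states T \<Longrightarrow> \<pi> \<in> perms srt \<Longrightarrow> raw_sat T P t \<Longrightarrow>
    raw_sat T (state_act T \<pi> P) (raw_act T \<pi> t)"
proof (induction t arbitrary: P \<pi> rule: raw_induct_act[where T = T])
  case (Conj f)
  then show ?case by (auto simp: ran_map_option_comp)
next
  case (Neg t)
  have "raw_sat T P t" if "raw_sat T (state_act T \<pi> P) (raw_act T \<pi> t)"
  proof -
    have "raw_sat T (state_act T (inverse \<pi>) (state_act T \<pi> P))
        (raw_act T (inverse \<pi>) (raw_act T \<pi> t))"
      using that Neg perm_actionD(1)[OF raws_action] perm_actionD(1)[OF states_action]
      by (intro Neg.IH) auto
    then show ?thesis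
      using Neg.prems
      by (simp add: perm_action_inverse(1)[OF raws_action] perm_action_inverse(1)[OF states_action])
  qed
  then show ?case using Neg.prems by auto
next
  case (Pred \<phi>)
  then show ?case by (auto intro: entails_act)
next
  case (Dia \<alpha> t)
  then have \<alpha>: "\<alpha> \<in> acts T" and t: "t \<in> raws T" "alpha_class T t \<subseteq> raws T"
    using alpha_class_subset_raws[of t] by auto
  from Dia.prems obtain \<sigma> P' where \<sigma>: "\<sigma> \<in> fixing srt (free \<alpha> (alpha_class T t))"
    and P': "fresh srt (state_act T) (bn T (act_act T \<sigma> \<alpha>)) P" "step T P (act_act T \<sigma> \<alpha>) P'"
      "raw_sat T P' (raw_act T \<sigma> t)"
    unfolding raw_sat_Dia by blast
  note \<sigma>' = fixing_perms[OF \<sigma>]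
  \<comment> \<open>Conjugating the witness \<sigma> by \<pi> makes it fix the free names of the
    renamed diamond and select the \<pi>-image of the variant chosen by \<sigma>.\<close>
  let ?\<tau> = "\<pi> * \<sigma> * inverse \<pi>"
  have \<tau>\<alpha>: "act_act T ?\<tau> (act_act T \<pi> \<alpha>) = act_act T \<pi> (act_act T \<sigma> \<alpha>)"
    using \<sigma>' Dia.prems(3) by (simp add: perm_actionD(3)[OF acts_action \<alpha>] mult.assoc)
  have \<tau>t: "raw_act T ?\<tau> (raw_act T \<pi> t) = raw_act T \<pi> (raw_act T \<sigma> t)"
    using \<sigma>' Dia.prems(3) by (simp add: perm_actionD(3)[OF raws_action t(1)] mult.assoc)
  have "?\<tau> \<in> fixing srt (free (act_act T \<pi> \<alpha>) (alpha_class T (raw_act T \<pi> t)))"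
    using fixing_conjugate[OF Dia.prems(3) \<sigma>] free_act[OF \<alpha> t(2) Dia.prems(3)]
      alpha_class_act[OF t(1) Dia.prems(3)] by simp
  moreover have "fresh srt (state_act T) (bn T (act_act T \<pi> (act_act T \<sigma> \<alpha>))) (state_act T \<pi> P)"
    using fresh_act[OF Dia.prems(2,3) P'(1)] bn_act[OF perm_actionD(1)[OF acts_action \<alpha> \<sigma>'] Dia.prems(3)]
    by simp
  moreover have "step T (state_act T \<pi> P) (act_act T \<pi> (act_act T \<sigma> \<alpha>)) (state_act T \<pi> P')"
    using step_act P' Dia.prems by blast
  moreover have "raw_sat T (state_act T \<pi> P') (raw_act T \<pi> (raw_act T \<sigma> t))"
    using P' Dia.prems \<sigma>' perm_actionD(1)[OF raws_action t(1)]
    by (intro Dia.IH) (auto simp: step_def)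
  ultimately show ?case
    unfolding raw_act_simps raw_sat_Dia using \<tau>\<alpha> \<tau>t by metis
qed

lemma raw_sat_act:
  assumes "t \<in> raws T" "P \<in> states T" "\<pi> \<in> perms srt"
  shows "raw_sat T (state_act T \<pi> P) (raw_act T \<pi> t) \<longleftrightarrow> raw_sat T P t"
  using raw_sat_act_imp[OF assms]
    raw_sat_act_imp[OF perm_actionD(1)[OF raws_action assms(1,3)]
      perm_actionD(1)[OF states_action assms(2,3)] perms_inverse[OF assms(3)]]
  by (auto simp: perm_action_inverse(1)[OF raws_action assms(1,3)]
      perm_action_inverse(1)[OF states_action assms(2,3)])

text \<open>Shifts a renaming from the formula to the state, where the support of a state or of a
  set of states can absorb it.\<close>

lemma raw_sat_act_iff:
  assumes "t \<in> raws T" "P \<in> states T" "\<pi> \<in> perms srt"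
  shows "raw_sat T P (raw_act T \<pi> t) \<longleftrightarrow> raw_sat T (state_act T (inverse \<pi>) P) t"
  using raw_sat_act[OF assms(1) perm_actionD(1)[OF states_action assms(2)] assms(3), of "inverse \<pi>"]
    perm_action_inverse(2)[OF states_action assms(2,3)] assms(3) by simp

text \<open>Satisfaction is well defined on classes. A diamond and its variant by \<sigma> quantify
  over the same stabiliser, and right translation by \<sigma> matches their witnesses.\<close>

lemma raw_sat_alpha:
  "t \<in> raws T \<Longrightarrow> P \<in> states T \<Longrightarrow> u \<in> alpha_class T t \<Longrightarrow> raw_sat T P u \<longleftrightarrow> raw_sat T P t"
proof (induction t arbitrary: P u rule: raw_induct)
  case (Conj f)
  then obtain g where g: "u = Conj g" "\<forall>v\<in>ran g. \<exists>s\<in>ran f. v \<in> alpha_class T s"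
      "\<forall>s\<in>ran f. \<exists>v\<in>ran g. v \<in> alpha_class T s"
    by auto
  have "raw_sat T P v = raw_sat T P s" if "s \<in> ran f" "v \<in> alpha_class T s" for s v
    using Conj that by auto
  then show ?case unfolding g(1) raw_sat.simps using g(2,3) by metis
next
  case (Dia \<alpha> t)
  then obtain \<sigma> v where \<sigma>: "\<sigma> \<in> fixing srt (free \<alpha> (alpha_class T t))" and v: "v \<in> alpha_class T t"
      and u: "u = raw_act T \<sigma> (Dia \<alpha> v)"
    using alpha_class_Dia_cases by (metis raws_simps(4))
  note \<sigma>' = fixing_perms[OF \<sigma>]
  let ?F = "fixing srt (free \<alpha> (alpha_class T t))"
  let ?sat = "\<lambda>\<rho>. fresh srt (state_act T) (bn T (act_act T \<rho> \<alpha>)) P \<and>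
     (\<exists>P'. step T P (act_act T \<rho> \<alpha>) P' \<and> raw_sat T P' (raw_act T \<rho> t))"
  have \<alpha>: "\<alpha> \<in> acts T" and t: "t \<in> raws T" "alpha_class T t \<subseteq> raws T" and v': "v \<in> raws T"
    using Dia.prems v alpha_class_subset_raws[of t] by auto
  \<comment> \<open>Moving \<rho> onto the state turns the claim about renamed subformulas into the
    induction hypothesis for unrenamed ones at another state.\<close>
  have IH: "raw_sat T P' (raw_act T \<rho> v) \<longleftrightarrow> raw_sat T P' (raw_act T \<rho> t)"
    if "P' \<in> states T" "\<rho> \<in> perms srt" for P' \<rho>
    using that by (simp add: Dia.IH[OF t(1) _ v] t v' raw_sat_act_iff perm_actionD(1)[OF states_action])
  have "alpha_class T (raw_act T \<sigma> v) = formula_act T \<sigma> (alpha_class T t)"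
    using alpha_class_act[OF v' \<sigma>'] alpha_class_eq[OF t(1) v] by simp
  \<comment> \<open>\<sigma> fixes the free names pointwise, so the diamond and its variant have the
    same ones.\<close>
  then have free: "free (act_act T \<sigma> \<alpha>) (alpha_class T (raw_act T \<sigma> v)) = free \<alpha> (alpha_class T t)"
    using free_act[OF \<alpha> t(2) \<sigma>'] name_set_act_fixing[OF \<sigma>] by simp
  have "raw_sat T P u \<longleftrightarrow> (\<exists>\<pi>\<in>?F. ?sat (\<pi> * \<sigma>))"
    unfolding u raw_act_simps raw_sat_Dia free
  proof (rule bex_cong[OF refl])
    fix \<pi> assume "\<pi> \<in> ?F"
    then have \<pi>: "\<pi> \<in> perms srt" by (rule fixing_perms)
    then show "(fresh srt (state_act T) (bn T (act_act T \<pi> (act_act T \<sigma> \<alpha>))) P \<and>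
        (\<exists>P'. step T P (act_act T \<pi> (act_act T \<sigma> \<alpha>)) P' \<and>
          raw_sat T P' (raw_act T \<pi> (raw_act T \<sigma> v)))) \<longleftrightarrow> ?sat (\<pi> * \<sigma>)"
      using IH[of _ "\<pi> * \<sigma>"] \<sigma>'
      by (auto simp: perm_actionD(3)[OF acts_action \<alpha>] perm_actionD(3)[OF raws_action v'] step_def)
  qed
  also have "\<dots> \<longleftrightarrow> (\<exists>\<rho>\<in>?F. ?sat \<rho>)"
  proof
    assume "\<exists>\<pi>\<in>?F. ?sat (\<pi> * \<sigma>)"
    then show "\<exists>\<rho>\<in>?F. ?sat \<rho>" using \<sigma> fixing_mult by blast
  next
    assume "\<exists>\<rho>\<in>?F. ?sat \<rho>"
    then obtain \<rho> where \<rho>: "\<rho> \<in> ?F" "?sat \<rho>" by blast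
    have "\<rho> * inverse \<sigma> \<in> ?F" "?sat (\<rho> * inverse \<sigma> * \<sigma>)"
      using \<rho> \<sigma> by (auto simp: mult.assoc)
    then show "\<exists>\<pi>\<in>?F. ?sat (\<pi> * \<sigma>)" by blast
  qed
  finally show ?case unfolding raw_sat_Dia .
qed auto

lemma satisfies_alpha_class:
  "t \<in> raws T \<Longrightarrow> P \<in> states T \<Longrightarrow> satisfies T P (alpha_class T t) \<longleftrightarrow> raw_sat T P t"
  using raw_sat_alpha alpha_class_refl unfolding satisfies_def by blast

end


section \<open>Characteristic formulas\<close>

text \<open>If \<open>B\<close> is at most countable, so is the product, and
  \<open>natLeq <o r\<close> applies; otherwise the product is no larger than
  \<open>B\<close>.\<close>

lemma card_of_countable_Times_ordLess:
  assumes "countable A" "natLeq <o r" "|B| <o r"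
  shows "|A \<times> B| <o r"
proof -
  have A: "|A| \<le>o natLeq" using assms(1) by (simp add: countable_card_le_natLeq)
  show ?thesis
  proof (cases "|B| \<le>o natLeq")
    case True
    then have "|A \<times> B| \<le>o natLeq"
      using A card_of_Times_ordLeq_infinite_Field natLeq_Card_order infinite_UNIV_nat
      by (metis Field_natLeq)
    then show ?thesis using assms(2) by (rule ordLeq_ordLess_trans)
  next
    case False
    then have B: "natLeq \<le>o |B|"
      using natLeq_Well_order card_of_Well_order ordLeq_total by blast
    then have "infinite (Field |B| )"
      by (metis Field_card_of Field_natLeq card_of_ordLeq_infinite card_of_nat infinite_UNIV_nat
          ordIso_ordLeq_trans)
    then have "|A \<times> B| \<le>o |B|"
      using ordLeq_transitive[OF A B] card_of_Card_order card_of_refl ordIso_imp_ordLeq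
      by (intro card_of_Times_ordLeq_infinite_Field) auto
    then show ?thesis using assms(3) by (rule ordLeq_ordLess_trans)
  qed
qed

text \<open>Conjuncts are indexed by a partial function on \<open>'k\<close>: an injection of
  \<open>D\<close> into the field of \<kappa>, inverted on its image, is such an indexing.\<close>

lemma ordLess_imp_ran:
  fixes \<kappa> :: "'k rel"
  assumes "Card_order \<kappa>" "|D| <o \<kappa>"
  obtains f :: "'k \<rightharpoonup> 'a" where "ran f = D"
proof -
  have "|D| \<le>o |Field \<kappa>|"
    using assms card_of_Field_ordIso ordIso_symmetric ordLeq_ordIso_trans ordLess_imp_ordLeq by blast
  then obtain h where h: "inj_on h D" "h ` D \<subseteq> Field \<kappa>"
    unfolding card_of_ordLeq[symmetric] by blast
  have "ran (\<lambda>k. if k \<in> h ` D then Some (inv_into D h k) else None) = inv_into D h ` h ` D"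
    by (auto simp: ran_def split: if_splits)
  also have "\<dots> = D" by (rule inv_into_image_cancel[OF h(1) subset_refl])
  finally have "ran (\<lambda>k. if k \<in> h ` D then Some (inv_into D h k) else None) = D" .
  then show ?thesis by (rule that)
qed

section \<open>Well-formed formulas: finite support, renaming and separation of states\<close>

context nominal_ts
begin

lemma alpha_class_image_act:
  "D \<subseteq> raws T \<Longrightarrow> \<pi> \<in> perms srt \<Longrightarrow>
    alpha_class T ` raw_act T \<pi> ` D = set_act (formula_act T) \<pi> (alpha_class T ` D)"
  unfolding set_act_def[of "formula_act T"] image_image
  by (intro image_cong) (auto simp: alpha_class_act)

lemma supports_Conj:
  assumes "ran f \<subseteq> raws T" "supports srt (set_act (formula_act T)) N (alpha_class T ` ran f)"
  shows "supports srt (formula_act T) N (alpha_class T (Conj f))"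
  unfolding supports_iff_fixing
proof
  fix \<pi> assume \<pi>: "\<pi> \<in> fixing srt N"
  then have "set_act (formula_act T) \<pi> (alpha_class T ` ran f) = alpha_class T ` ran f"
    using assms(2) by (simp add: supports_iff_fixing)
  moreover have "formula_act T \<pi> (conj_class (alpha_class T ` ran f)) =
      conj_class (formula_act T \<pi> ` alpha_class T ` ran f)"
    using assms(1) alpha_class_subset_raws fixing_perms[OF \<pi>] by (intro conj_class_act) blast+
  ultimately show "formula_act T \<pi> (alpha_class T (Conj f)) = alpha_class T (Conj f)"
    unfolding alpha_class_Conj by (metis set_act_def)
qed

text \<open>Needed so that \<open>supp\<close> of an action paired with a formula really supports
  the pair. At conjunctions it comes from the side condition on the conjuncts; at negations and
  diamonds equivariance of classes passes supports on.\<close>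

lemma finitely_supported_alpha_class:
  "well_formed T \<kappa> t \<Longrightarrow> finitely_supported srt (formula_act T) (alpha_class T t)"
proof (induction t rule: raw_induct)
  case (Conj f)
  then show ?case
    using supports_Conj[of f] well_formed_raws
    unfolding finitely_supported_def well_formed.simps by blast
next
  case (Neg t)
  then obtain N where N: "finite N" "supports srt (formula_act T) N (alpha_class T t)"
    by (auto simp: finitely_supported_def)
  have "formula_act T \<pi> (alpha_class T (Neg t)) = alpha_class T (Neg t)" if \<pi>: "\<pi> \<in> fixing srt N" for \<pi>
  proof -
    have "Neg t \<in> raws T" "t \<in> raws T"
      using Neg.prems well_formed_raws[of T \<kappa> "Neg t"] by auto
    then have "formula_act T \<pi> (alpha_class T (Neg t)) = alpha_class T (Neg (raw_act T \<pi> t))"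
        "alpha_class T (raw_act T \<pi> t) = alpha_class T t"
      using alpha_class_act[of "Neg t" \<pi>] alpha_class_act[of t \<pi>] fixing_perms[OF \<pi>] N(2) \<pi>
      by (auto simp: supports_iff_fixing simp del: alpha_class.simps)
    then show ?thesis by simp
  qed
  then show ?case using N(1) by (auto simp: finitely_supported_def supports_iff_fixing)
next
  case (Pred \<phi>)
  then have "finitely_supported srt (pred_act T) \<phi>"
    using nominal_sets(2) by (simp add: nominal_set_def)
  then show ?case by (auto simp: finitely_supported_def supports_iff_fixing set_act_def)
next
  case (Dia \<alpha> t)
  then obtain N where N: "finite N" "supports srt (formula_act T) N (alpha_class T t)"
    by (auto simp: finitely_supported_def)
  obtain M where M: "finite M" "supports srt (act_act T) M \<alpha>"
    using acts_finitely_supported Dia.prems by (auto simp: finitely_supported_def)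
  have "formula_act T \<pi> (alpha_class T (Dia \<alpha> t)) = alpha_class T (Dia \<alpha> t)"
    if \<pi>: "\<pi> \<in> fixing srt (M \<union> N)" for \<pi>
  proof -
    have \<pi>MN: "\<pi> \<in> fixing srt M" "\<pi> \<in> fixing srt N" using \<pi> by (auto simp: fixing_def)
    have "Dia \<alpha> t \<in> raws T" "t \<in> raws T"
      using Dia.prems well_formed_raws[of T \<kappa> "Dia \<alpha> t"] by auto
    then have "formula_act T \<pi> (alpha_class T (Dia \<alpha> t)) = alpha_class T (Dia \<alpha> (raw_act T \<pi> t))"
        "alpha_class T (raw_act T \<pi> t) = alpha_class T t"
      using alpha_class_act[of "Dia \<alpha> t" \<pi>] alpha_class_act[of t \<pi>] fixing_perms[OF \<pi>] M(2) N(2) \<pi>MN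
      by (auto simp: supports_iff_fixing simp del: alpha_class.simps)
    then show ?thesis by simp
  qed
  then show ?case
    using M(1) N(1) unfolding finitely_supported_def supports_iff_fixing by blast
qed

text \<open>Makes orbits of well-formed formulas available as conjuncts. At a conjunction, \<pi>
  carries a finite support of the set of conjuncts to one of its image, and the image is no
  larger.\<close>

lemma well_formed_act: "well_formed T \<kappa> t \<Longrightarrow> \<pi> \<in> perms srt \<Longrightarrow> well_formed T \<kappa> (raw_act T \<pi> t)"
proof (induction t rule: raw_induct)
  case (Conj f)
  have f: "ran f \<subseteq> raws T" using Conj.prems well_formed_raws by auto
  obtain N where N: "finite N" "supports srt (set_act (formula_act T)) N (alpha_class T ` ran f)"
    using Conj.prems by (auto simp: finitely_supported_def)
  have "alpha_class T ` ran f \<in> Pow (Pow (raws T))"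
    using f alpha_class_subset_raws by fastforce
  then have "supports srt (set_act (formula_act T)) (name_set_act \<pi> N)
      (set_act (formula_act T) \<pi> (alpha_class T ` ran f))"
    by (rule supports_perm[OF perm_action_set[OF formulas_action] _ Conj.prems(2) N(2)])
  then have "finitely_supported srt (set_act (formula_act T)) (alpha_class T ` raw_act T \<pi> ` ran f)"
    unfolding finitely_supported_def alpha_class_image_act[OF f Conj.prems(2)]
    using N(1) by (intro exI[of _ "name_set_act \<pi> N"]) (simp add: name_set_act_def[of \<pi> N])
  moreover have "|alpha_class T ` raw_act T \<pi> ` ran f| <o \<kappa>"
    unfolding alpha_class_image_act[OF f Conj.prems(2)] set_act_def[of "formula_act T"]
    using Conj.prems(1) card_of_image ordLeq_ordLess_trans unfolding well_formed.simps by blast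
  ultimately show ?case using Conj by (auto simp: ran_map_option_comp)
qed (use perm_actionD(1)[OF preds_action] perm_actionD(1)[OF acts_action] in auto)

text \<open>The conjuncts are the orbit of \<open>G\<close> under the stabiliser of
  \<open>N\<close>. Each permutation in the stabiliser maps the orbit onto itself, so
  \<open>N\<close> supports the conjunction, and the orbit is no larger than a countable set times
  \<open>G\<close>.\<close>

lemma symmetric_conjunction:
  fixes \<kappa> :: "'k rel" and G :: "('k, 'pr, 'ac) raw set"
  assumes \<kappa>: "Card_order \<kappa>" "natLeq <o \<kappa>" and G: "|G| <o \<kappa>" "\<And>u. u \<in> G \<Longrightarrow> well_formed T \<kappa> u"
    and N: "finite N"
  shows "\<exists>t :: ('k, 'pr, 'ac) raw. well_formed T \<kappa> t \<and>
    supports srt (formula_act T) N (alpha_class T t) \<and>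
    (\<forall>P. raw_sat T P t \<longleftrightarrow> (\<forall>u\<in>G. \<forall>\<pi>\<in>fixing srt N. raw_sat T P (raw_act T \<pi> u)))"
proof -
  define D where "D = (\<lambda>(\<pi>, u). raw_act T \<pi> u) ` (fixing srt N \<times> G)"
  have "countable (fixing srt N)"
    using sorting by (intro countable_perm) (simp add: name_sorting_def)
  then have D: "|D| <o \<kappa>"
    unfolding D_def using card_of_countable_Times_ordLess[OF _ \<kappa>(2) G(1)] card_of_image
      ordLeq_ordLess_trans by blast
  from ordLess_imp_ran[OF \<kappa>(1) this] obtain f :: "'k \<rightharpoonup> ('k, 'pr, 'ac) raw" where f: "ran f = D" .
  have wf: "well_formed T \<kappa> t" if "t \<in> D" for t
    using that G(2) by (auto simp: D_def intro: well_formed_act dest: fixing_perms)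
  then have raws: "D \<subseteq> raws T" using well_formed_raws by blast
  have sub: "raw_act T \<sigma> ` D \<subseteq> D" if "\<sigma> \<in> fixing srt N" for \<sigma>
  proof -
    have "raw_act T \<sigma> (raw_act T \<pi> u) = raw_act T (\<sigma> * \<pi>) u" if "\<pi> \<in> fixing srt N" "u \<in> G" for \<pi> u
      using that \<open>\<sigma> \<in> fixing srt N\<close> G(2) well_formed_raws fixing_perms
      by (intro perm_actionD(3)[OF raws_action]) blast+
    then show ?thesis using that by (force simp: D_def)
  qed
  have eq: "raw_act T \<sigma> ` D = D" if \<sigma>: "\<sigma> \<in> fixing srt N" for \<sigma>
  proof
    show "raw_act T \<sigma> ` D \<subseteq> D" by (rule sub[OF \<sigma>])
    show "D \<subseteq> raw_act T \<sigma> ` D"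
    proof
      fix t assume t: "t \<in> D"
      have "raw_act T \<sigma> (raw_act T (inverse \<sigma>) t) = t"
        using t raws by (intro perm_action_inverse(2)[OF raws_action] fixing_perms[OF \<sigma>]) auto
      moreover have "raw_act T (inverse \<sigma>) t \<in> D" using t sub[OF fixing_inverse[OF \<sigma>]] by blast
      ultimately show "t \<in> raw_act T \<sigma> ` D" by (metis imageI)
    qed
  qed
  \<comment> \<open>Invariance of the set of trees passes to the set of their classes by
    equivariance.\<close>
  then have supports: "supports srt (set_act (formula_act T)) N (alpha_class T ` ran f)"
    unfolding supports_iff_fixing f
    using alpha_class_image_act[OF raws fixing_perms] by metis
  have "|alpha_class T ` ran f| <o \<kappa>"
    unfolding f using D card_of_image ordLeq_ordLess_trans by blast
  with supports N wf have "well_formed T \<kappa> (Conj f)"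
    by (auto simp: f finitely_supported_def)
  moreover have "supports srt (formula_act T) N (alpha_class T (Conj f))"
    using supports_Conj supports raws f by blast
  moreover have "raw_sat T P (Conj f) \<longleftrightarrow> (\<forall>u\<in>G. \<forall>\<pi>\<in>fixing srt N. raw_sat T P (raw_act T \<pi> u))" for P
    by (auto simp: f D_def)
  ultimately show ?thesis by blast
qed

text \<open>Closing the chosen formulas under the stabiliser keeps them true at \<open>P\<close>,
  whose support is \<open>N\<close>. Supporting the result by the same \<open>N\<close> later bounds
  the free names of a diamond built from it.\<close>

lemma separating_formula:
  fixes \<kappa> :: "'k rel"
  assumes \<kappa>: "Card_order \<kappa>" "natLeq <o \<kappa>" "|states T| <o \<kappa>"
    and P: "P \<in> states T" and Y: "Y \<subseteq> states T"
    and sep: "\<And>Q. Q \<in> Y \<Longrightarrow>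
      \<exists>t :: ('k, 'pr, 'ac) raw. well_formed T \<kappa> t \<and> raw_sat T P t \<and> \<not> raw_sat T Q t"
    and N: "finite N" "supports srt (state_act T) N P"
  shows "\<exists>t :: ('k, 'pr, 'ac) raw. well_formed T \<kappa> t \<and>
    supports srt (formula_act T) N (alpha_class T t) \<and>
    raw_sat T P t \<and> (\<forall>Q\<in>Y. \<not> raw_sat T Q t)"
proof -
  obtain B :: "'st \<Rightarrow> ('k, 'pr, 'ac) raw" where
    B: "\<And>Q. Q \<in> Y \<Longrightarrow> well_formed T \<kappa> (B Q) \<and> raw_sat T P (B Q) \<and> \<not> raw_sat T Q (B Q)"
    using sep by metis
  have "|B ` Y| \<le>o |Y|" "|Y| \<le>o |states T|" using Y by (simp_all add: card_of_image card_of_mono1)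
  then have "|B ` Y| <o \<kappa>" using \<kappa>(3) by (metis ordLeq_ordLess_trans)
  moreover have "\<And>u. u \<in> B ` Y \<Longrightarrow> well_formed T \<kappa> u" using B by auto
  ultimately obtain t where t: "well_formed T \<kappa> t" "supports srt (formula_act T) N (alpha_class T t)"
    "\<And>P. raw_sat T P t \<longleftrightarrow> (\<forall>u\<in>B ` Y. \<forall>\<pi>\<in>fixing srt N. raw_sat T P (raw_act T \<pi> u))"
    using symmetric_conjunction[OF \<kappa>(1,2) _ _ N(1), of "B ` Y"] by auto
  have "raw_sat T P (raw_act T \<pi> (B Q))" if "Q \<in> Y" "\<pi> \<in> fixing srt N" for Q \<pi>
  proof -
    have "state_act T (inverse \<pi>) P = P"
      using N(2) that(2) by (simp add: supports_iff_fixing)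
    then show ?thesis
      using B[OF that(1)] raw_sat_act_iff[OF _ P fixing_perms[OF that(2)]] well_formed_raws by metis
  qed
  then have "raw_sat T P t" unfolding t(3) by blast
  moreover have "\<not> raw_sat T Q t" if Q: "Q \<in> Y" for Q
  proof
    assume "raw_sat T Q t"
    \<comment> \<open>The identity is in the stabiliser, so the formula chosen against
      \<open>Q\<close> is itself a conjunct.\<close>
    then have "raw_sat T Q (raw_act T 1 (B Q))" using Q unfolding t(3) by blast
    moreover have "raw_act T 1 (B Q) = B Q"
      using B[OF Q] well_formed_raws by (blast intro: perm_actionD(2)[OF raws_action])
    ultimately show False using B[OF Q] by simp
  qed
  ultimately show ?thesis using t(1,2) by blast
qed

text \<open>The witness for \<open>\<langle>\<alpha>\<rangle>A\<close> may be another alpha-variant. It is moved back to \<open>\<alpha>\<close> itself by a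
  permutation of the two sets of bound names only, which leaves \<open>Q\<close> unchanged.\<close>

lemma raw_sat_Dia_fresh:
  assumes wf: "well_formed T \<kappa> t" and \<alpha>: "\<alpha> \<in> acts T" and Q: "Q \<in> states T"
    and fr: "fresh srt (state_act T) (bn T \<alpha>) Q" and sat: "raw_sat T Q (Dia \<alpha> t)"
  obtains Q' where "step T Q \<alpha> Q'" "raw_sat T Q' t"
proof -
  let ?A = "alpha_class T t"
  let ?S = "supp srt pair_act (\<alpha>, ?A)"
  have t: "t \<in> raws T" "?A \<subseteq> raws T"
    using well_formed_raws[OF wf] alpha_class_subset_raws by auto
  obtain \<pi> Q'' where \<pi>: "\<pi> \<in> fixing srt (free \<alpha> ?A)"
    and Q'': "fresh srt (state_act T) (bn T (act_act T \<pi> \<alpha>)) Q" "step T Q (act_act T \<pi> \<alpha>) Q''"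
      "raw_sat T Q'' (raw_act T \<pi> t)"
    using sat unfolding raw_sat_Dia by blast
  note \<pi>' = fixing_perms[OF \<pi>]
  let ?B = "name_set_act \<pi> (bn T \<alpha>)"
  have bn: "bn T (act_act T \<pi> \<alpha>) = ?B" by (rule bn_act[OF \<alpha> \<pi>'])
  have "finite ?B" using finite_bn[OF \<alpha>] by (simp add: name_set_act_def)
  from local_permutation[OF perms_inverse[OF \<pi>'] this]
  obtain \<sigma> where \<sigma>: "\<sigma> \<in> fixing srt (- (?B \<union> name_set_act (inverse \<pi>) ?B))"
    "\<And>a. a \<in> ?B \<Longrightarrow> \<sigma> \<langle>$\<rangle> a = inverse \<pi> \<langle>$\<rangle> a"
    by blast
  have "name_set_act (inverse \<pi>) ?B = bn T \<alpha>"
    by (simp add: name_set_act_def image_image)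
  with \<sigma>(1) have \<sigma>1: "\<sigma> \<in> fixing srt (- (?B \<union> bn T \<alpha>))" by simp
  note \<sigma>' = fixing_perms[OF \<sigma>(1)]
  \<comment> \<open>On bound names \<sigma> undoes \<pi>. A free name is fixed by \<pi>, hence by
    injectivity is not the image of a bound name, hence lies outside the names \<sigma> may
    move.\<close>
  have "\<sigma> \<langle>$\<rangle> (\<pi> \<langle>$\<rangle> a) = a" if a: "a \<in> ?S" for a
  proof (cases "a \<in> bn T \<alpha>")
    case True
    then show ?thesis using \<sigma>(2)[of "\<pi> \<langle>$\<rangle> a"] by (simp add: name_set_act_def)
  next
    case False
    then have "\<pi> \<langle>$\<rangle> a = a" using fixing_apply[OF \<pi>] a by simp
    moreover have "a \<notin> ?B"
    proof
      assume "a \<in> ?B"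
      then obtain b where b: "b \<in> bn T \<alpha>" "a = \<pi> \<langle>$\<rangle> b" by (auto simp: name_set_act_def)
      with \<open>\<pi> \<langle>$\<rangle> a = a\<close> have "a = b" by (simp add: apply_inj)
      with b False show False by simp
    qed
    ultimately show ?thesis using fixing_apply[OF \<sigma>1, of a] False by simp
  qed
  then have fixS: "\<sigma> * \<pi> \<in> fixing srt ?S" using \<sigma>' \<pi>' by (auto simp: fixing_def)
  have "finitely_supported srt pair_act (\<alpha>, ?A)"
  proof -
    obtain M N where "finite M" "supports srt (act_act T) M \<alpha>" "finite N"
        "supports srt (formula_act T) N ?A"
      using acts_finitely_supported[OF \<alpha>] finitely_supported_alpha_class[OF wf]
      unfolding finitely_supported_def by blast
    then have "finite (M \<union> N)" "supports srt pair_act (M \<union> N) (\<alpha>, ?A)"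
      unfolding supports_prod by (auto intro: supports_mono)
    then show ?thesis unfolding finitely_supported_def by blast
  qed
  then have "supports srt pair_act ?S (\<alpha>, ?A)"
    using \<alpha> t by (intro supp_supports(2)[OF sorting pair_action]) auto
  then have \<sigma>\<pi>: "act_act T (\<sigma> * \<pi>) \<alpha> = \<alpha>" "formula_act T (\<sigma> * \<pi>) ?A = ?A"
    using fixS unfolding supports_prod by (simp_all add: supports_iff_fixing)
  have "\<sigma> \<in> fixing srt (supp srt (state_act T) Q)"
    using \<sigma>1 fr Q''(1) unfolding bn by (auto simp: fixing_def fresh_def)
  then have \<sigma>Q: "state_act T \<sigma> Q = Q"
    using supp_supports(2)[OF sorting states_action Q states_finitely_supported[OF Q]]
    by (simp add: supports_iff_fixing)
  have "step T Q \<alpha> (state_act T \<sigma> Q'')"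
    using step_act[OF Q''(2) \<sigma>'] \<sigma>Q \<sigma>\<pi>(1) perm_actionD(3)[OF acts_action \<alpha> \<sigma>' \<pi>'] by simp
  moreover have "raw_sat T (state_act T \<sigma> Q'') t"
  proof -
    have Q''s: "Q'' \<in> states T" using Q''(2) by (simp add: step_def)
    have "raw_sat T (state_act T \<sigma> Q'') (raw_act T (\<sigma> * \<pi>) t)"
      using raw_sat_act[OF perm_actionD(1)[OF raws_action t(1) \<pi>'] Q''s \<sigma>'] Q''(3)
        perm_actionD(3)[OF raws_action t(1) \<sigma>' \<pi>'] by simp
    \<comment> \<open>Only the class of \<open>t\<close> is known to be fixed; the tree itself may
      change, but within its class, which does not affect satisfaction.\<close>
    moreover have "raw_act T (\<sigma> * \<pi>) t \<in> ?A"
      using alpha_class_refl[OF t(1)] \<sigma>\<pi>(2) unfolding set_act_def by (metis imageI)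
    ultimately show ?thesis
      using raw_sat_alpha[OF t(1) perm_actionD(1)[OF states_action Q''s \<sigma>']] by blast
  qed
  ultimately show ?thesis by (rule that)
qed

text \<open>Phrased with raw trees; by \<open>satisfies_alpha_class\<close> this is agreement on all
  formulas of \<open>formulas T \<kappa>\<close>.\<close>

definition logically_equivalent :: "'k rel \<Rightarrow> 'st rel" where
  "logically_equivalent \<kappa> = {(P, Q). P \<in> states T \<and> Q \<in> states T \<and>
     (\<forall>t :: ('k, 'pr, 'ac) raw. well_formed T \<kappa> t \<longrightarrow> raw_sat T P t = raw_sat T Q t)}"

text \<open>Negation makes the choice of side immaterial: a formula true only at \<open>Q\<close> is
  replaced by its negation.\<close>

lemma distinguishing_formula:
  fixes \<kappa> :: "'k rel"
  assumes "P \<in> states T" "Q \<in> states T" "(P, Q) \<notin> logically_equivalent \<kappa>"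
  shows "\<exists>t :: ('k, 'pr, 'ac) raw. well_formed T \<kappa> t \<and> raw_sat T P t \<and> \<not> raw_sat T Q t"
proof -
  obtain t :: "('k, 'pr, 'ac) raw" where "well_formed T \<kappa> t" "raw_sat T P t \<noteq> raw_sat T Q t"
    using assms by (auto simp: logically_equivalent_def)
  then show ?thesis
    by (cases "raw_sat T P t") (auto intro: exI[of _ t] exI[of _ "Neg t"])
qed

lemma bisimulation_logically_equivalent:
  fixes \<kappa> :: "'k rel"
  assumes \<kappa>: "Card_order \<kappa>" "natLeq <o \<kappa>" "|states T| <o \<kappa>"
  shows "bisimulation T (logically_equivalent \<kappa>)"
proof -
  have "\<exists>Q'\<in>states T. step T Q \<alpha> Q' \<and> (P', Q') \<in> logically_equivalent \<kappa>"
    if PQ: "(P, Q) \<in> logically_equivalent \<kappa>" and fr: "fresh srt (state_act T) (bn T \<alpha>) Q"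
      and step: "step T P \<alpha> P'" for P Q \<alpha> P'
  proof (rule ccontr)
    assume contr: "\<not> ?thesis"
    have states: "P \<in> states T" "Q \<in> states T" and \<alpha>: "\<alpha> \<in> acts T" and P': "P' \<in> states T"
      using PQ step by (auto simp: logically_equivalent_def step_def)
    \<comment> \<open>The support of the whole residual supports both \<alpha> and P', so the
      separating formula can be supported by names of the residual alone.\<close>
    let ?N = "supp srt (residual_act T) (\<alpha>, P')"
    have "finitely_supported srt (residual_act T) (\<alpha>, P')"
    proof -
      obtain M N where "finite M" "supports srt (act_act T) M \<alpha>" "finite N"
          "supports srt (state_act T) N P'"
        using acts_finitely_supported[OF \<alpha>] states_finitely_supported[OF P']
        unfolding finitely_supported_def by blast
      then have "finite (M \<union> N)" "supports srt (residual_act T) (M \<union> N) (\<alpha>, P')"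
        unfolding supports_prod by (auto intro: supports_mono)
      then show ?thesis unfolding finitely_supported_def by blast
    qed
    then have N: "finite ?N" "supports srt (act_act T) ?N \<alpha>" "supports srt (state_act T) ?N P'"
      using supp_supports[OF sorting residual_action, of "(\<alpha>, P')"] \<alpha> P'
      by (auto simp: supports_prod)
    let ?Y = "{Q'. step T Q \<alpha> Q'}"
    have Y: "?Y \<subseteq> states T" by (auto simp: step_def)
    have sep: "\<exists>t :: ('k, 'pr, 'ac) raw. well_formed T \<kappa> t \<and> raw_sat T P' t \<and> \<not> raw_sat T Q' t"
      if "Q' \<in> ?Y" for Q'
      using that contr Y by (intro distinguishing_formula[OF P']) auto
    obtain t :: "('k, 'pr, 'ac) raw" where t: "well_formed T \<kappa> t"
      "supports srt (formula_act T) ?N (alpha_class T t)"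
      "raw_sat T P' t" "\<And>Q'. Q' \<in> ?Y \<Longrightarrow> \<not> raw_sat T Q' t"
      using separating_formula[OF \<kappa> P' Y sep N(1,3)] by blast
    \<comment> \<open>The bound names of \<alpha> are assumed fresh for \<open>Q\<close> only, while
      satisfaction at \<open>P\<close> asks for a variant fresh for \<open>P\<close>. Including
      \<open>?N\<close> makes the renaming fix the free names of both the diamond and the
      residual.\<close>
    let ?Z = "?N \<union> supp srt (state_act T) P"
    have "finite ?Z"
      using N(1) supp_supports(1)[OF sorting states_action states(1)
          states_finitely_supported[OF states(1)]] by simp
    from fresh_renaming[OF sorting finite_bn[OF \<alpha>] this]
    obtain \<pi> where \<pi>: "\<pi> \<in> fixing srt (?Z - bn T \<alpha>)" "name_set_act \<pi> (bn T \<alpha>) \<inter> ?Z = {}" .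
    note \<pi>' = fixing_perms[OF \<pi>(1)]
    have "supports srt pair_act ?N (\<alpha>, alpha_class T t)"
      using N(2) t(2) by (simp add: supports_prod)
    then have "supp srt pair_act (\<alpha>, alpha_class T t) \<subseteq> ?N"
      using N(1) by (intro supp_subset)
    then have "\<pi> \<in> fixing srt (free \<alpha> (alpha_class T t))" "\<pi> \<in> fixing srt (?N - bn T \<alpha>)"
      using \<pi>(1) by (auto simp: fixing_def)
    moreover have "fresh srt (state_act T) (bn T (act_act T \<pi> \<alpha>)) P"
      unfolding bn_act[OF \<alpha> \<pi>'] using \<pi>(2) by (auto simp: fresh_def)
    moreover have "raw_sat T (state_act T \<pi> P') (raw_act T \<pi> t)"
      using raw_sat_act[OF well_formed_raws[OF t(1)] P' \<pi>'] t(3) by simp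
    \<comment> \<open>The renamed transition starts at the unchanged \<open>P\<close> and ends at
      \<pi>P', where the renamed formula holds by equivariance.\<close>
    ultimately have "raw_sat T P (Dia \<alpha> t)"
      unfolding raw_sat_Dia using step_rename[OF step] by blast
    moreover have "well_formed T \<kappa> (Dia \<alpha> t)" using \<alpha> t(1) by simp
    ultimately have "raw_sat T Q (Dia \<alpha> t)"
      using PQ by (auto simp: logically_equivalent_def simp del: raw_sat.simps)
    then show False
      using raw_sat_Dia_fresh[OF t(1) \<alpha> states(2) fr] t(4) by blast
  qed
  moreover have "(Q, \<phi>) \<in> entails T"
    if "(P, Q) \<in> logically_equivalent \<kappa>" "\<phi> \<in> preds T" "(P, \<phi>) \<in> entails T" for P Q \<phi>
  proof -
    have "raw_sat T P (Pred \<phi> :: ('k, 'pr, 'ac) raw) = raw_sat T Q (Pred \<phi> :: ('k, 'pr, 'ac) raw)"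
      using that(1,2) unfolding logically_equivalent_def
      by (auto simp del: raw_sat.simps)
    then show ?thesis using that(3) by simp
  qed
  moreover have "logically_equivalent \<kappa> \<subseteq> states T \<times> states T" "sym (logically_equivalent \<kappa>)"
    by (auto simp: logically_equivalent_def sym_def)
  ultimately show ?thesis unfolding bisimulation_def by blast
qed

text \<open>Logical equivalence is a bisimulation, so every state not bisimilar to \<open>P\<close>
  is distinguished from it; one conjunction then excludes all these states together.\<close>

lemma characteristic_formula:
  fixes \<kappa> :: "'k rel"
  assumes \<kappa>: "Card_order \<kappa>" "natLeq <o \<kappa>" "|states T| <o \<kappa>" and P: "P \<in> states T"
  shows "\<exists>t :: ('k, 'pr, 'ac) raw. well_formed T \<kappa> t \<and> raw_sat T P t \<and>
    (\<forall>Q\<in>states T. raw_sat T Q t \<longrightarrow> bisimilar T P Q)"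
proof -
  let ?Y = "{Q \<in> states T. \<not> bisimilar T P Q}"
  have sep: "\<exists>t :: ('k, 'pr, 'ac) raw. well_formed T \<kappa> t \<and> raw_sat T P t \<and> \<not> raw_sat T Q t"
    if "Q \<in> ?Y" for Q
    using that bisimulation_logically_equivalent[OF \<kappa>]
    by (intro distinguishing_formula[OF P]) (auto simp: bisimilar_def)
  obtain N where N: "finite N" "supports srt (state_act T) N P"
    using states_finitely_supported[OF P] by (auto simp: finitely_supported_def)
  have "?Y \<subseteq> states T" by blast
  from separating_formula[OF \<kappa> P this sep N] show ?thesis by blast
qed

end

section \<open>The formula defining the given set of states\<close>

theorem theorem3p17:
  fixes T :: "('n, 's, 'st, 'pr, 'ac) nts"
    and \<kappa> :: "'k rel"
    and S :: "'st set"
  assumes "nominal_transition_system T"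
    and "Card_order \<kappa>" and "natLeq <o \<kappa>" and "|states T| <o \<kappa>"
    and "S \<subseteq> states T"
    and "finitely_supported (name_sort T) (set_act (state_act T)) S"
    and "\<And>P Q. P \<in> S \<Longrightarrow> bisimilar T P Q \<Longrightarrow> Q \<in> S"
  shows "\<exists>A\<in>formulas T \<kappa>. \<forall>P\<in>states T. satisfies T P A \<longleftrightarrow> P \<in> S"
proof -
  interpret nominal_ts T by standard (rule assms(1))
  note \<kappa> = assms(2-4)
  obtain N where N: "finite N" "supports srt (set_act (state_act T)) N S"
    using assms(6) by (auto simp: finitely_supported_def)
  have "\<forall>P\<in>S. \<exists>t :: ('k, 'pr, 'ac) raw. well_formed T \<kappa> t \<and> raw_sat T P t \<and>
      (\<forall>Q\<in>states T. raw_sat T Q t \<longrightarrow> bisimilar T P Q)"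
    using characteristic_formula[OF \<kappa>] assms(5) by blast
  then obtain char :: "'st \<Rightarrow> ('k, 'pr, 'ac) raw" where
    char: "\<And>P. P \<in> S \<Longrightarrow> well_formed T \<kappa> (char P)" "\<And>P. P \<in> S \<Longrightarrow> raw_sat T P (char P)"
      "\<And>P Q. P \<in> S \<Longrightarrow> Q \<in> states T \<Longrightarrow> raw_sat T Q (char P) \<Longrightarrow> bisimilar T P Q"
    by metis
  \<comment> \<open>Disjunction is expressed by negating a conjunction of negations;
    \<open>Neg t\<close> below is the disjunction of the orbits.\<close>
  let ?G = "(\<lambda>P. Neg (char P)) ` S"
  have "|?G| \<le>o |S|" "|S| \<le>o |states T|"
    using assms(5) by (simp_all add: card_of_image card_of_mono1)
  then have "|?G| <o \<kappa>" using \<kappa>(3) by (metis ordLeq_ordLess_trans)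
  moreover have "\<And>u. u \<in> ?G \<Longrightarrow> well_formed T \<kappa> u" using char(1) by auto
  ultimately obtain t where t: "well_formed T \<kappa> t"
    "\<And>P. raw_sat T P t \<longleftrightarrow> (\<forall>u\<in>?G. \<forall>\<pi>\<in>fixing srt N. raw_sat T P (raw_act T \<pi> u))"
    using symmetric_conjunction[OF \<kappa>(1,2) _ _ N(1), of ?G] by auto
  have "raw_sat T P (Neg t) \<longleftrightarrow> P \<in> S" if P: "P \<in> states T" for P
  proof
    assume "raw_sat T P (Neg t)"
    then obtain R \<pi> where R: "R \<in> S" and \<pi>: "\<pi> \<in> fixing srt N"
      and "raw_sat T P (raw_act T \<pi> (char R))"
      using t(2) by auto
    \<comment> \<open>A disjunct taken from the orbit of \<open>char R\<close> only shows that
      \<pi>^-1 P is bisimilar to \<open>R\<close>. So \<pi>^-1 P lies in S, and P lies in \<pi>S,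
      which is S because \<pi> fixes a support of S.\<close>
    then have "raw_sat T (state_act T (inverse \<pi>) P) (char R)"
      using raw_sat_act_iff[OF well_formed_raws[OF char(1)[OF R]] P fixing_perms[OF \<pi>]] by simp
    then have "bisimilar T R (state_act T (inverse \<pi>) P)"
      using R P \<pi> by (intro char(3) perm_actionD(1)[OF states_action] perms_inverse fixing_perms)
    then have "state_act T (inverse \<pi>) P \<in> S" using R assms(7) by blast
    then have "state_act T \<pi> (state_act T (inverse \<pi>) P) \<in> set_act (state_act T) \<pi> S"
      by (simp add: set_act_def)
    then show "P \<in> S"
      using N(2) \<pi> perm_action_inverse(2)[OF states_action P fixing_perms[OF \<pi>]]
      by (simp add: supports_iff_fixing)
  next
    assume "P \<in> S"
    \<comment> \<open>The orbit contains the formula of \<open>P\<close> itself, through the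
      identity.\<close>
    then have "\<not> raw_sat T P (raw_act T 1 (Neg (char P)))"
      using char(2) perm_actionD(2)[OF raws_action well_formed_raws[OF char(1)]] by simp
    then have "\<not> raw_sat T P t" using \<open>P \<in> S\<close> unfolding t(2) by blast
    then show "raw_sat T P (Neg t)" by simp
  qed
  moreover have "well_formed T \<kappa> (Neg t)" using t(1) by simp
  ultimately show ?thesis
    using satisfies_alpha_class[OF well_formed_raws] unfolding formulas_def by blast
qed

end
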